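(* Let $\hat{\mathcal{S}}=\mathcal{S}\oplus\mathbb{R}^3$ be the central extension of the Lie algebra $\mathcal{S}$ of smooth divergence-free vector fields on the torus $\mathbb{T}^3$, with bracket $$[(u,\eta),(w,\mu)]=\Big([u,w],\int_{\mathbb{T}^3}w\times u\,\frac{d^3x}{(2\pi)^3}\Big).$$ Then $$\langle(u,\eta),(w,\mu)\rangle=\int_{\mathbb{T}^3}(u-\bar u)\cdot\mathrm{curl}^{-1}(w-\bar w)\,\frac{d^3x}{(2\pi)^3}+\eta\cdot\bar w+\mu\cdot\bar u$$ is an invariant inner product on $\hat{\mathcal{S}}$: it is a nondegenerate symmetric bilinear form, and for all $X,Y,Z\in\hat{\mathcal{S}}$, $$\langle[Y,X],Z\rangle+\langle X,[Y,Z]\rangle=0.$$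
   Context: $\mathbb{T}^3=\mathbb{R}^3/(2\pi\mathbb{Z})^3$. $\mathcal{S}$ is the Lie algebra of smooth vector fields $u:\mathbb{T}^3\to\mathbb{R}^3$ with $\nabla\cdot u=0$, under $[u,w]=u\cdot\nabla w-w\cdot\nabla u$. The average of $u$ is $\bar u=\int_{\mathbb{T}^3}u\,\frac{d^3x}{(2\pi)^3}\in\mathbb{R}^3$. The curl operator is invertible on the space of divergence-free fields of zero average, and $\mathrm{curl}^{-1}$ denotes its inverse there. The map $(u,w)\mapsto\int w\times u\,\frac{d^3x}{(2\pi)^3}$ is an $\mathbb{R}^3$-valued Lie algebra 2-cocycle of $\mathcal{S}$, so $\hat{\mathcal{S}}$ is a Lie algebra. "Inner product" does not include positivity. *)

theory Defs
  imports "HOL-Analysis.Analysis"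
begin

section \<open>Smooth maps between Euclidean spaces\<close>

text \<open>
  Since the domain is finite-dimensional, continuity of all directional derivatives up to order
  \<open>k\<close> is continuity of all derivatives up to order \<open>k\<close>.
\<close>

fun Ck :: "nat \<Rightarrow> ('a::euclidean_space \<Rightarrow> 'b::euclidean_space) \<Rightarrow> bool" where
  "Ck 0 f \<longleftrightarrow> continuous_on UNIV f"
| "Ck (Suc k) f \<longleftrightarrow>
     (\<forall>x. f differentiable (at x)) \<and> (\<forall>v. Ck k (\<lambda>x. frechet_derivative f (at x) v))"

definition smooth :: "('a::euclidean_space \<Rightarrow> 'b::euclidean_space) \<Rightarrow> bool"
  where "smooth f \<longleftrightarrow> (\<forall>k. Ck k f)"

lemma Ck_continuous: "Ck k f \<Longrightarrow> continuous_on UNIV f"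
  by (cases k)
    (auto simp: continuous_on_eq_continuous_within differentiable_imp_continuous_within)

lemma Ck_SucD: "Ck (Suc k) f \<Longrightarrow> Ck k f"
proof (induction k arbitrary: f)
  case 0
  then show ?case using Ck_continuous[of "Suc 0" f] by simp
qed auto

lemma frechet_derivative_eqI:
  "(f has_derivative f') (at x) \<Longrightarrow> frechet_derivative f (at x) = f'"
  using frechet_derivative_at by metis

lemma Ck_SucI:
  assumes "\<And>x. (f has_derivative f' x) (at x)" "\<And>v. Ck k (\<lambda>x. f' x v)"
  shows "Ck (Suc k) f"
proof -
  have "frechet_derivative f (at x) = f' x" for x
    using assms(1) frechet_derivative_eqI by blast
  then show ?thesis
    using assms by (auto simp: differentiable_def)
qed

lemma Ck_SucE:
  assumes "Ck (Suc k) f"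
  shows "(f has_derivative frechet_derivative f (at x)) (at x)"
    and "Ck k (\<lambda>x. frechet_derivative f (at x) v)"
  using assms frechet_derivative_works by auto

lemma Ck_const: "Ck k (\<lambda>x. c)"
proof (induction k arbitrary: c)
  case (Suc k)
  show ?case
    by (rule Ck_SucI[where f' = "\<lambda>_ _. 0"]) (use Suc in auto)
qed auto

lemma Ck_add: "Ck k f \<Longrightarrow> Ck k g \<Longrightarrow> Ck k (\<lambda>x. f x + g x)"
proof (induction k arbitrary: f g)
  case 0
  then show ?case by (auto intro: continuous_on_add)
next
  case (Suc k)
  note f = Ck_SucE[OF Suc.prems(1)] and g = Ck_SucE[OF Suc.prems(2)]
  show ?case
    by (rule Ck_SucI, rule has_derivative_add[OF f(1) g(1)], rule Suc.IH[OF f(2) g(2)])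
qed

lemma Ck_sum: "(\<And>i. i \<in> I \<Longrightarrow> Ck k (f i)) \<Longrightarrow> Ck k (\<lambda>x. \<Sum>i\<in>I. f i x)"
  by (induction I rule: infinite_finite_induct) (auto intro: Ck_add Ck_const)

lemma Ck_bilinear:
  assumes h: "bounded_bilinear h"
  shows "Ck k f \<Longrightarrow> Ck k g \<Longrightarrow> Ck k (\<lambda>x. h (f x) (g x))"
proof (induction k arbitrary: f g)
  case 0
  then show ?case
    by (auto intro: bounded_bilinear.continuous_on[OF h])
next
  case (Suc k)
  note f = Ck_SucE[OF Suc.prems(1)] and g = Ck_SucE[OF Suc.prems(2)]
  show ?case
    by (rule Ck_SucI, rule bounded_bilinear.FDERIV[OF h f(1) g(1)],
        intro Ck_add Suc.IH f(2) g(2) Suc.prems[THEN Ck_SucD])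
qed

lemma Ck_linear:
  assumes "bounded_linear L" "Ck k f"
  shows "Ck k (\<lambda>x. L (f x))"
  using assms(2)
proof (induction k arbitrary: f)
  case 0
  then show ?case
    by (auto intro: bounded_linear.continuous_on[OF assms(1)])
next
  case (Suc k)
  note f = Ck_SucE[OF Suc.prems(1)]
  show ?case
    by (rule Ck_SucI, rule bounded_linear.has_derivative[OF assms(1) f(1)], rule Suc.IH[OF f(2)])
qed

lemma smooth_const: "smooth (\<lambda>x. c)"
  by (simp add: smooth_def Ck_const)

lemma smooth_add: "smooth f \<Longrightarrow> smooth g \<Longrightarrow> smooth (\<lambda>x. f x + g x)"
  by (simp add: smooth_def Ck_add)

lemma smooth_sum: "(\<And>i. i \<in> I \<Longrightarrow> smooth (f i)) \<Longrightarrow> smooth (\<lambda>x. \<Sum>i\<in>I. f i x)"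
  by (simp add: smooth_def Ck_sum)

lemma smooth_linear: "bounded_linear L \<Longrightarrow> smooth f \<Longrightarrow> smooth (\<lambda>x. L (f x))"
  by (simp add: smooth_def Ck_linear)

lemma smooth_bilinear:
  "bounded_bilinear h \<Longrightarrow> smooth f \<Longrightarrow> smooth g \<Longrightarrow> smooth (\<lambda>x. h (f x) (g x))"
  by (simp add: smooth_def Ck_bilinear)

lemma smooth_scaleR: "smooth f \<Longrightarrow> smooth (\<lambda>x. c *\<^sub>R f x)"
  by (rule smooth_linear[OF bounded_linear_scaleR_right])

lemma smooth_diff: "smooth f \<Longrightarrow> smooth g \<Longrightarrow> smooth (\<lambda>x. f x - g x)"
  using smooth_add[OF _ smooth_scaleR[of g "-1"], of f] by simp

lemma smooth_derivative: "smooth f \<Longrightarrow> smooth (\<lambda>x. frechet_derivative f (at x) v)"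
  unfolding smooth_def using Ck_SucE(2) by blast

lemma smooth_has_derivative:
  "smooth f \<Longrightarrow> (f has_derivative frechet_derivative f (at x)) (at x)"
  unfolding smooth_def using Ck_SucE(1) by blast

lemma smooth_continuous: "smooth f \<Longrightarrow> continuous_on UNIV f"
  unfolding smooth_def using Ck.simps(1) by blast


subsection \<open>Symmetry of second derivatives\<close>

lemma mean_value_line:
  fixes f :: "'a::euclidean_space \<Rightarrow> real"
  assumes f: "\<And>x. (f has_derivative f' x) (at x)" and h: "0 < h"
  obtains s where "0 < s" "s < h"
    "f (a + h *\<^sub>R u + b) - f (a + h *\<^sub>R u + c) - (f (a + b) - f (a + c))
      = h * (f' (a + s *\<^sub>R u + b) u - f' (a + s *\<^sub>R u + c) u)"
proof -
  define g where "g = (\<lambda>t. f (a + t *\<^sub>R u + b) - f (a + t *\<^sub>R u + c))"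
  define g' where "g' = (\<lambda>t. f' (a + t *\<^sub>R u + b) u - f' (a + t *\<^sub>R u + c) u)"
  have line: "((\<lambda>t. f (a + t *\<^sub>R u + d)) has_real_derivative f' (a + t *\<^sub>R u + d) u) (at t)" for d t
  proof -
    have "((\<lambda>t. a + t *\<^sub>R u + d) has_derivative (\<lambda>t. t *\<^sub>R u)) (at t)"
      by (auto intro!: derivative_eq_intros)
    from has_derivative_compose[OF this f]
    have "((\<lambda>t. f (a + t *\<^sub>R u + d)) has_derivative (\<lambda>s. f' (a + t *\<^sub>R u + d) (s *\<^sub>R u))) (at t)" .
    moreover have "f' (a + t *\<^sub>R u + d) (s *\<^sub>R u) = f' (a + t *\<^sub>R u + d) u * s" for s
      using linear_scale[OF has_derivative_linear[OF f]] by simp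
    ultimately show ?thesis
      by (simp add: has_field_derivative_def)
  qed
  have g: "(g has_real_derivative g' t) (at t)" for t
    unfolding g_def g'_def by (intro DERIV_diff line)
  obtain s where "0 < s" "s < h" "g h - g 0 = (h - 0) * g' s"
    using MVT2[OF h, of g g'] g by blast
  then show thesis
    using that by (simp add: g_def g'_def)
qed

lemma second_difference:
  fixes f :: "'a::euclidean_space \<Rightarrow> real"
  assumes f: "smooth f" and h: "0 < h"
  obtains s t where "0 < s" "s < h" "0 < t" "t < h"
    "f (a + h *\<^sub>R u + h *\<^sub>R v) - f (a + h *\<^sub>R u) - (f (a + h *\<^sub>R v) - f a)
      = h\<^sup>2 * frechet_derivative (\<lambda>x. frechet_derivative f (at x) u) (at (a + s *\<^sub>R u + t *\<^sub>R v)) v"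
proof -
  let ?F = "\<lambda>x. frechet_derivative f (at x) u"
  obtain s where s: "0 < s" "s < h"
    "f (a + h *\<^sub>R u + h *\<^sub>R v) - f (a + h *\<^sub>R u + 0) - (f (a + h *\<^sub>R v) - f (a + 0))
      = h * (?F (a + s *\<^sub>R u + h *\<^sub>R v) - ?F (a + s *\<^sub>R u + 0))"
    using mean_value_line[OF smooth_has_derivative[OF f] h] by metis
  obtain t where t: "0 < t" "t < h"
    "?F (a + s *\<^sub>R u + h *\<^sub>R v + 0) - 0 - (?F (a + s *\<^sub>R u + 0) - 0)
      = h * (frechet_derivative ?F (at (a + s *\<^sub>R u + t *\<^sub>R v + 0)) v - 0)"
  proof -
    define g where "g = (\<lambda>t. ?F (a + s *\<^sub>R u + t *\<^sub>R v))"
    define g' where "g' = (\<lambda>t. frechet_derivative ?F (at (a + s *\<^sub>R u + t *\<^sub>R v)) v)"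
    have F: "(?F has_derivative frechet_derivative ?F (at x)) (at x)" for x
      by (intro smooth_has_derivative smooth_derivative f)
    have "(g has_real_derivative g' t) (at t)" for t
    proof -
      have "((\<lambda>t. a + s *\<^sub>R u + t *\<^sub>R v) has_derivative (\<lambda>t. t *\<^sub>R v)) (at t)"
        by (auto intro!: derivative_eq_intros)
      from has_derivative_compose[OF this F]
      have "(g has_derivative
          (\<lambda>r. frechet_derivative ?F (at (a + s *\<^sub>R u + t *\<^sub>R v)) (r *\<^sub>R v))) (at t)"
        by (simp add: g_def)
      moreover have "frechet_derivative ?F (at y) (r *\<^sub>R v) = frechet_derivative ?F (at y) v * r" for y r
        using linear_scale[OF has_derivative_linear[OF F]] by simp
      ultimately show ?thesis
        by (simp add: has_field_derivative_def g'_def)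
    qed
    then obtain t where "0 < t" "t < h" "g h - g 0 = (h - 0) * g' t"
      using MVT2[OF h, of g g'] by blast
    then show thesis
      using that by (simp add: g_def g'_def)
  qed
  show thesis
    by (rule that[OF s(1,2) t(1,2)]) (use s(3) t(3) in \<open>simp add: power2_eq_square\<close>)
qed

lemma second_derivative_limit:
  fixes f :: "'a::euclidean_space \<Rightarrow> real"
  assumes f: "smooth f"
  shows "(\<lambda>n. (f (a + (1 / real (Suc n)) *\<^sub>R u + (1 / real (Suc n)) *\<^sub>R v)
            - f (a + (1 / real (Suc n)) *\<^sub>R u)
            - (f (a + (1 / real (Suc n)) *\<^sub>R v) - f a)) / (1 / real (Suc n))\<^sup>2)
     \<longlonglongrightarrow> frechet_derivative (\<lambda>x. frechet_derivative f (at x) u) (at a) v"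
    (is "?Q \<longlonglongrightarrow> ?D a")
proof -
  have "\<exists>s t. 0 < s \<and> s < 1 / real (Suc n) \<and> 0 < t \<and> t < 1 / real (Suc n) \<and>
      ?Q n = ?D (a + s *\<^sub>R u + t *\<^sub>R v)" for n
  proof -
    have h: "0 < 1 / real (Suc n)" by simp
    show ?thesis
      by (rule second_difference[OF f h, of a u v], intro exI conjI, assumption+)
        (use h in \<open>simp only: nonzero_mult_div_cancel_left power2_eq_square\<close>, simp)
  qed
  then obtain s t where st: "\<And>n. 0 < s n" "\<And>n. s n < 1 / real (Suc n)"
      "\<And>n. 0 < t n" "\<And>n. t n < 1 / real (Suc n)"
      "\<And>n. ?Q n = ?D (a + s n *\<^sub>R u + t n *\<^sub>R v)"
    by metis
  have lim: "(\<lambda>n. 1 / real (Suc n)) \<longlonglongrightarrow> 0"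
    using LIMSEQ_inverse_real_of_nat by (simp add: inverse_eq_divide)
  have "s \<longlonglongrightarrow> 0" "t \<longlonglongrightarrow> 0"
    by (rule tendsto_sandwich[OF _ _ tendsto_const lim];
        intro always_eventually allI less_imp_le st)+
  then have "(\<lambda>n. a + s n *\<^sub>R u + t n *\<^sub>R v) \<longlonglongrightarrow> a + 0 *\<^sub>R u + 0 *\<^sub>R v"
    by (intro tendsto_intros)
  moreover have "isCont ?D a"
    using smooth_continuous[OF smooth_derivative[OF smooth_derivative[OF f]]]
    by (simp add: continuous_on_eq_continuous_within)
  ultimately have "(\<lambda>n. ?D (a + s n *\<^sub>R u + t n *\<^sub>R v)) \<longlonglongrightarrow> ?D a"
    using isCont_tendsto_compose[of a ?D] by simp
  then show ?thesis
    by (simp only: st(5))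
qed

lemma second_derivative_symmetric_real:
  fixes f :: "'a::euclidean_space \<Rightarrow> real"
  assumes f: "smooth f"
  shows "frechet_derivative (\<lambda>x. frechet_derivative f (at x) u) (at a) v
       = frechet_derivative (\<lambda>x. frechet_derivative f (at x) v) (at a) u"
  by (rule LIMSEQ_unique[OF second_derivative_limit[OF f]])
    (use second_derivative_limit[OF f, of a v u] in \<open>simp add: algebra_simps\<close>)

lemma frechet_derivative_linear:
  assumes "bounded_linear L" "smooth f"
  shows "frechet_derivative (\<lambda>x. L (f x)) (at x) v = L (frechet_derivative f (at x) v)"
  by (subst frechet_derivative_eqI[OF
      bounded_linear.has_derivative[OF assms(1) smooth_has_derivative[OF assms(2)]]]) simp

lemma second_derivative_symmetric:
  assumes f: "smooth f"
  shows "frechet_derivative (\<lambda>x. frechet_derivative f (at x) u) (at a) v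
       = frechet_derivative (\<lambda>x. frechet_derivative f (at x) v) (at a) u"
proof (rule euclidean_eqI)
  fix b
  note L = bounded_linear_inner_left[of b]
  have "frechet_derivative (\<lambda>x. frechet_derivative f (at x) u) (at a) v \<bullet> b
      = frechet_derivative (\<lambda>x. frechet_derivative (\<lambda>x. f x \<bullet> b) (at x) u) (at a) v" for u v
    by (simp add: frechet_derivative_linear[OF L] f smooth_derivative)
  then show "frechet_derivative (\<lambda>x. frechet_derivative f (at x) u) (at a) v \<bullet> b
      = frechet_derivative (\<lambda>x. frechet_derivative f (at x) v) (at a) u \<bullet> b"
    using second_derivative_symmetric_real[OF smooth_linear[OF L f]] by simp
qed


section \<open>Vector calculus\<close>

definition partial :: "3 \<Rightarrow> (real^3 \<Rightarrow> 'b::euclidean_space) \<Rightarrow> real^3 \<Rightarrow> 'b"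
  where "partial i f x = frechet_derivative f (at x) (axis i 1)"

definition divergence :: "(real^3 \<Rightarrow> real^3) \<Rightarrow> real^3 \<Rightarrow> real"
  where "divergence u x = (\<Sum>i\<in>UNIV. partial i u x $ i)"

definition curl :: "(real^3 \<Rightarrow> real^3) \<Rightarrow> real^3 \<Rightarrow> real^3"
  where "curl u x = vector
    [partial 2 u x $ 3 - partial 3 u x $ 2,
     partial 3 u x $ 1 - partial 1 u x $ 3,
     partial 1 u x $ 2 - partial 2 u x $ 1]"

text \<open>The directional derivative \<open>u \<cdot> \<nabla>w\<close>.\<close>

definition advect :: "(real^3 \<Rightarrow> real^3) \<Rightarrow> (real^3 \<Rightarrow> real^3) \<Rightarrow> real^3 \<Rightarrow> real^3"
  where "advect u w x = (\<Sum>i\<in>UNIV. u x $ i *\<^sub>R partial i w x)"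

text \<open>Functions on the torus are the functions on \<open>\<real>\<^sup>3\<close> with period \<open>2\<pi>\<close> in each coordinate.\<close>

definition periodic :: "(real^3 \<Rightarrow> 'b) \<Rightarrow> bool"
  where "periodic f \<longleftrightarrow> (\<forall>x i. f (x + axis i (2 * pi)) = f x)"

definition average :: "(real^3 \<Rightarrow> 'b::euclidean_space) \<Rightarrow> 'b"
  where "average f = (1 / (2 * pi) ^ 3) *\<^sub>R integral (cbox 0 (\<chi> i. 2 * pi)) f"

lemma smooth_partial: "smooth f \<Longrightarrow> smooth (partial i f)"
  unfolding partial_def by (rule smooth_derivative)

lemma smooth_nth: "smooth f \<Longrightarrow> smooth (\<lambda>x. f x $ i)"
  by (rule smooth_linear[OF bounded_linear_vec_nth])

lemma partial_linear:
  "bounded_linear L \<Longrightarrow> smooth f \<Longrightarrow> partial i (\<lambda>x. L (f x)) x = L (partial i f x)"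
  unfolding partial_def by (rule frechet_derivative_linear)

lemma partial_nth: "smooth f \<Longrightarrow> partial i (\<lambda>x. f x $ j) x = partial i f x $ j"
  by (rule partial_linear[OF bounded_linear_vec_nth])

lemma partial_scaleR_const: "smooth f \<Longrightarrow> partial i (\<lambda>x. c *\<^sub>R f x) x = c *\<^sub>R partial i f x"
  by (rule partial_linear[OF bounded_linear_scaleR_right])

lemma partial_const: "partial i (\<lambda>x. c) x = 0"
  unfolding partial_def by (subst frechet_derivative_eqI[OF has_derivative_const]) simp

lemma partial_add:
  "smooth f \<Longrightarrow> smooth g \<Longrightarrow> partial i (\<lambda>x. f x + g x) x = partial i f x + partial i g x"
  unfolding partial_def
  by (subst frechet_derivative_eqI[OF
      has_derivative_add[OF smooth_has_derivative smooth_has_derivative]]) auto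

lemma partial_diff:
  "smooth f \<Longrightarrow> smooth g \<Longrightarrow> partial i (\<lambda>x. f x - g x) x = partial i f x - partial i g x"
  unfolding partial_def
  by (subst frechet_derivative_eqI[OF
      has_derivative_diff[OF smooth_has_derivative smooth_has_derivative]]) auto

lemma partial_sum:
  "(\<And>j. j \<in> I \<Longrightarrow> smooth (f j)) \<Longrightarrow>
    partial i (\<lambda>x. \<Sum>j\<in>I. f j x) x = (\<Sum>j\<in>I. partial i (f j) x)"
  by (induction I rule: infinite_finite_induct)
    (auto simp: partial_const partial_add smooth_sum)

lemma partial_mult:
  fixes f g :: "real^3 \<Rightarrow> real"
  assumes "smooth f" "smooth g"
  shows "partial i (\<lambda>x. f x * g x) x = f x * partial i g x + partial i f x * g x"
  unfolding partial_def
  by (subst frechet_derivative_eqI[OF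
      has_derivative_mult[OF smooth_has_derivative smooth_has_derivative]]) (use assms in auto)

lemma partial_commute: "smooth f \<Longrightarrow> partial i (partial j f) x = partial j (partial i f) x"
  unfolding partial_def by (rule second_derivative_symmetric)

lemma periodic_partial:
  assumes "smooth f" "periodic f"
  shows "periodic (partial i f)"
  unfolding periodic_def
proof (intro allI)
  fix x j
  define p :: "real^3" where "p = axis j (2 * pi)"
  have "((\<lambda>x. x + p) has_derivative (\<lambda>x. x)) (at x)"
    by (auto intro!: derivative_eq_intros)
  from has_derivative_compose[OF this smooth_has_derivative[OF assms(1)]]
  have "((\<lambda>x. f (x + p)) has_derivative frechet_derivative f (at (x + p))) (at x)" .
  moreover have "(\<lambda>x. f (x + p)) = f"
    using assms(2) by (simp add: periodic_def p_def)
  ultimately have "frechet_derivative f (at x) = frechet_derivative f (at (x + p))"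
    by (simp add: frechet_derivative_eqI)
  then show "partial i f (x + axis j (2 * pi)) = partial i f x"
    by (simp add: partial_def p_def)
qed

lemma curl_eq: "curl u x = (\<Sum>i\<in>UNIV. cross3 (axis i 1) (partial i u x))"
  by (simp add: curl_def vec_eq_iff forall_3 sum_3 cross3_def axis_def)

lemma curl_nth:
    "curl u x $ 1 = partial 2 u x $ 3 - partial 3 u x $ 2"
    "curl u x $ 2 = partial 3 u x $ 1 - partial 1 u x $ 3"
    "curl u x $ 3 = partial 1 u x $ 2 - partial 2 u x $ 1"
  by (simp_all add: curl_def)

lemma smooth_curl: "smooth u \<Longrightarrow> smooth (curl u)"
  unfolding curl_eq[abs_def]
  by (intro smooth_sum smooth_partial
      smooth_bilinear[OF bilinear_cross[unfolded bilinear_conv_bounded_bilinear]] smooth_const)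

lemma smooth_advect: "smooth u \<Longrightarrow> smooth w \<Longrightarrow> smooth (advect u w)"
  unfolding advect_def[abs_def]
  by (intro smooth_sum smooth_partial smooth_nth smooth_bilinear[OF bounded_bilinear_scaleR])

lemma periodic_curl: "smooth u \<Longrightarrow> periodic u \<Longrightarrow> periodic (curl u)"
  using periodic_partial[of u] by (simp add: periodic_def curl_def)

lemma periodic_advect: "smooth w \<Longrightarrow> periodic u \<Longrightarrow> periodic w \<Longrightarrow> periodic (advect u w)"
  using periodic_partial[of w] by (simp add: periodic_def advect_def)

lemma divergence_curl:
  assumes u: "smooth u"
  shows "divergence (curl u) x = 0"
proof -
  note s = u smooth_partial smooth_nth
  have "divergence (curl u) x = (\<Sum>i\<in>UNIV. partial i (\<lambda>x. curl u x $ i) x)"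
    by (simp add: divergence_def partial_nth smooth_curl u)
  also have "\<dots> = 0"
    by (simp add: sum_3 curl_nth u partial_diff s partial_nth
        partial_commute[of u 2 1] partial_commute[of u 3 1] partial_commute[of u 3 2])
  finally show ?thesis .
qed

lemma divergence_advect:
  assumes u: "smooth u" and w: "smooth w" and "\<And>x. divergence w x = 0"
  shows "divergence (advect u w) x
      = (\<Sum>i\<in>UNIV. \<Sum>j\<in>UNIV. partial i u x $ j * partial j w x $ i)"
proof -
  have 0: "(\<Sum>i\<in>UNIV. partial i (partial j w) x $ i) = 0" for j
  proof -
    have "(\<Sum>i\<in>UNIV. partial i (partial j w) x $ i) = (\<Sum>i\<in>UNIV. partial j (partial i w) x $ i)"
      by (rule sum.cong[OF refl]) (simp only: partial_commute[OF w, of _ j])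
    also have "\<dots> = partial j (\<lambda>x. \<Sum>i\<in>UNIV. partial i w x $ i) x"
      by (simp add: partial_sum partial_nth smooth_nth smooth_partial w)
    also have "(\<lambda>x. \<Sum>i\<in>UNIV. partial i w x $ i) = (\<lambda>x. 0)"
      using assms(3) by (simp add: divergence_def)
    finally show ?thesis
      by (simp add: partial_const)
  qed
  have "divergence (advect u w) x = (\<Sum>i\<in>UNIV. partial i (\<lambda>x. advect u w x $ i) x)"
    by (simp add: divergence_def partial_nth smooth_advect u w)
  also have "\<dots> = (\<Sum>i\<in>UNIV. \<Sum>j\<in>UNIV.
      u x $ j * partial i (partial j w) x $ i + partial i u x $ j * partial j w x $ i)"
    by (simp add: advect_def partial_sum partial_mult partial_nth smooth_nth smooth_partial u w
        smooth_bilinear[OF bounded_bilinear_mult])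
  also have "\<dots> = (\<Sum>j\<in>UNIV. u x $ j * (\<Sum>i\<in>UNIV. partial i (partial j w) x $ i))
      + (\<Sum>i\<in>UNIV. \<Sum>j\<in>UNIV. partial i u x $ j * partial j w x $ i)"
    by (simp add: sum.distrib sum_distrib_left,
        rule sum.swap)
  finally show ?thesis
    by (simp add: 0)
qed

lemma divergence_bracket:
  assumes "smooth u" "smooth w" "\<And>x. divergence u x = 0" "\<And>x. divergence w x = 0"
  shows "divergence (\<lambda>x. advect u w x - advect w u x) x = 0"
proof -
  have "divergence (\<lambda>x. advect u w x - advect w u x) x
      = divergence (advect u w) x - divergence (advect w u) x"
    by (simp add: divergence_def partial_diff smooth_advect assms sum_subtractf)
  also have "\<dots> = 0"
    using sum.swap[of "\<lambda>i j. partial i u x $ j * partial j w x $ i" UNIV UNIV]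
    by (simp add: divergence_advect assms mult.commute)
  finally show ?thesis .
qed


section \<open>The Lie algebra of divergence-free fields\<close>

typedef solenoidal =
  "{u :: real^3 \<Rightarrow> real^3. smooth u \<and> periodic u \<and> (\<forall>x. divergence u x = 0)}"
  morphisms field Solenoidal
  by (rule exI[of _ "\<lambda>_. 0"]) (simp add: smooth_const periodic_def divergence_def partial_const)

setup_lifting type_definition_solenoidal

instantiation solenoidal :: real_vector
begin

lift_definition zero_solenoidal :: solenoidal is "\<lambda>x. 0"
  by (simp add: smooth_const periodic_def divergence_def partial_const)

lift_definition plus_solenoidal :: "solenoidal \<Rightarrow> solenoidal \<Rightarrow> solenoidal"
  is "\<lambda>u w x. u x + w x"
  by (simp add: smooth_add periodic_def divergence_def partial_add sum.distrib)

lift_definition minus_solenoidal :: "solenoidal \<Rightarrow> solenoidal \<Rightarrow> solenoidal"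
  is "\<lambda>u w x. u x - w x"
  by (simp add: smooth_diff periodic_def divergence_def partial_diff sum_subtractf)

lift_definition scaleR_solenoidal :: "real \<Rightarrow> solenoidal \<Rightarrow> solenoidal"
  is "\<lambda>c u x. c *\<^sub>R u x"
  by (simp add: smooth_scaleR periodic_def divergence_def partial_scaleR_const
      flip: sum_distrib_left)

definition uminus_solenoidal :: "solenoidal \<Rightarrow> solenoidal"
  where "uminus_solenoidal u = (-1) *\<^sub>R u"

instance
  by standard (unfold uminus_solenoidal_def, (transfer, simp add: algebra_simps)+)

end

lift_definition const_field :: "real^3 \<Rightarrow> solenoidal" is "\<lambda>c x. c"
  by (simp add: smooth_const periodic_def divergence_def partial_const)

lift_definition bracket :: "solenoidal \<Rightarrow> solenoidal \<Rightarrow> solenoidal"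
  is "\<lambda>u w x. advect u w x - advect w u x"
proof (intro CollectI conjI allI; elim CollectE conjE)
  fix u w :: "real^3 \<Rightarrow> real^3"
  assume u: "smooth u" "periodic u" "\<forall>x. divergence u x = 0"
    and w: "smooth w" "periodic w" "\<forall>x. divergence w x = 0"
  show "smooth (\<lambda>x. advect u w x - advect w u x)"
    by (intro smooth_diff smooth_advect u w)
  show "periodic (\<lambda>x. advect u w x - advect w u x)"
    using periodic_advect[of w u] periodic_advect[of u w] u w by (simp add: periodic_def)
  show "divergence (\<lambda>x. advect u w x - advect w u x) x = 0" for x
    using divergence_bracket u w by blast
qed

lift_definition curl_field :: "solenoidal \<Rightarrow> solenoidal" is curl
  by (simp add: smooth_curl periodic_curl divergence_curl)

definition mean :: "solenoidal \<Rightarrow> real^3"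
  where "mean u = average (field u)"

definition zero_mean :: "solenoidal set"
  where "zero_mean = {u. mean u = 0}"

text \<open>
  The curl is a bijection of the fields of zero average onto themselves; off this subspace the
  value of \<open>curl_inv\<close> is arbitrary, and it is not used there.
\<close>

definition curl_inv :: "solenoidal \<Rightarrow> solenoidal"
  where "curl_inv = the_inv_into zero_mean curl_field"


section \<open>The central extension and its inner product\<close>

type_synonym extension = "solenoidal \<times> (real^3)"

definition ext_bracket :: "extension \<Rightarrow> extension \<Rightarrow> extension"
  where "ext_bracket = (\<lambda>(u, \<eta>) (w, \<mu>).
    (bracket u w, average (\<lambda>x. cross3 (field w x) (field u x))))"

definition ext_form :: "extension \<Rightarrow> extension \<Rightarrow> real"
  where "ext_form = (\<lambda>(u, \<eta>) (w, \<mu>).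
    average (\<lambda>x. field (u - const_field (mean u)) x
                 \<bullet> field (curl_inv (w - const_field (mean w))) x)
    + \<eta> \<bullet> mean w + \<mu> \<bullet> mean u)"

definition nondegenerate :: "('a::real_vector \<Rightarrow> 'a \<Rightarrow> real) \<Rightarrow> bool"
  where "nondegenerate B \<longleftrightarrow> (\<forall>x. (\<forall>y. B x y = 0) \<longrightarrow> x = 0)"

text \<open>Positivity is not required of an inner product.\<close>

definition invariant_inner_product ::
    "('a::real_vector \<Rightarrow> 'a \<Rightarrow> 'a) \<Rightarrow> ('a \<Rightarrow> 'a \<Rightarrow> real) \<Rightarrow> bool"
  where "invariant_inner_product br B \<longleftrightarrow>
    bilinear B \<and> (\<forall>x y. B x y = B y x) \<and> nondegenerate B \<and>
    (\<forall>x y z. B (br y x) z + B x (br y z) = 0)"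

end

theory Submission
  imports Defs
begin

text \<open>
  For divergence-free fields \<open>[y, u] = - curl (y \<times> u)\<close>, and the curl is symmetric for the \<open>L\<^sup>2\<close>
  pairing. Hence \<open>\<langle>[Y, X], Z\<rangle>\<close> is the average of \<open>(u \<times> y) \<cdot> w\<close>, the cocycle supplying exactly the
  contribution of the average of \<open>w\<close>; the triple product is alternating, which gives invariance.
  Nondegeneracy follows by testing against constant fields, central elements, and \<open>(curl u, 0)\<close>.

  The curl is onto the fields of zero average because \<open>curl (curl A) = - \<Delta>A\<close> for divergence-free
  \<open>A\<close>, so that \<open>curl A\<close> is a preimage of \<open>w\<close> when \<open>- \<Delta>A = w\<close>. The Poisson equation is solved by
  Fourier series. Surjectivity and symmetry together make the curl injective there.
\<close>


section \<open>Averages over the torus\<close>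

text \<open>The obstacle is that the solution of the Poisson equation must again be smooth, while
  differentiating its series term by term would call for decay estimates of every order. The
  solution is therefore written as \<open>average (\<lambda>y. K y * h (x + y))\<close>: derivatives
  in \<open>x\<close> fall on the smooth factor \<open>h\<close>, and the kernel \<open>K\<close>
  only has to be continuous. Pointwise Fourier inversion rests on uniqueness. The series of a smooth
  \<open>f\<close> converges uniformly to a continuous function with the same coefficients as
  \<open>f\<close>, and a continuous periodic function whose coefficients all vanish is zero; this
  is seen by testing it against high powers of a trigonometric polynomial that peaks at a single
  point.\<close>

abbreviation torus_cell :: "(real^3) set"
  where "torus_cell \<equiv> cbox 0 (\<chi> i. 2 * pi)"

lemma content_torus_cell: "measure lborel torus_cell = (2 * pi) ^ 3"
proof -
  have "0 \<in> torus_cell" by (simp add: mem_box_cart)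
  then have "torus_cell \<noteq> {}" by blast
  then show ?thesis by (simp add: content_cbox_cart prod_constant)
qed

lemma integrable_torus_cell:
  fixes f :: "real^3 \<Rightarrow> 'b::euclidean_space"
  assumes "continuous_on UNIV f"
  shows "f integrable_on torus_cell"
  using assms continuous_on_subset integrable_continuous by blast

lemma average_const: "average (\<lambda>x. c) = c"
  by (simp add: average_def content_torus_cell)

lemma average_add:
  assumes "continuous_on UNIV f" "continuous_on UNIV g"
  shows "average (\<lambda>x. f x + g x) = average f + average g"
  by (simp add: average_def integral_add integrable_torus_cell assms scaleR_add_right)

lemma average_linear:
  assumes "bounded_linear L" "continuous_on UNIV f"
  shows "average (\<lambda>x. L (f x)) = L (average f)"
  using integral_linear[OF integrable_torus_cell[OF assms(2)] assms(1)]
  by (simp add: average_def o_def linear_scale[OF bounded_linear.linear[OF assms(1)]])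

lemma average_mult: "continuous_on UNIV f \<Longrightarrow> average (\<lambda>x. c * f x) = c * average f"
  for f :: "real^3 \<Rightarrow> real"
  by (rule average_linear[OF bounded_linear_mult_right])

lemma average_diff:
  assumes "continuous_on UNIV f" "continuous_on UNIV g"
  shows "average (\<lambda>x. f x - g x) = average f - average g"
  by (simp add: average_def integral_diff integrable_torus_cell assms scaleR_diff_right)

lemma average_sum:
  assumes "\<And>i. i \<in> I \<Longrightarrow> continuous_on UNIV (f i)"
  shows "average (\<lambda>x. \<Sum>i\<in>I. f i x) = (\<Sum>i\<in>I. average (f i))"
  using assms
  by (induction I rule: infinite_finite_induct)
    (auto simp: average_const average_add continuous_on_sum)

lemma average_nth: "continuous_on UNIV f \<Longrightarrow> average (\<lambda>x. f x $ i) = average f $ i"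
  by (rule average_linear[OF bounded_linear_vec_nth])

lemma average_abs_le:
  fixes f :: "real^3 \<Rightarrow> real"
  assumes "continuous_on UNIV f" "\<And>x. \<bar>f x\<bar> \<le> B"
  shows "\<bar>average f\<bar> \<le> B"
proof -
  have "norm (integral torus_cell f) \<le> B * (2 * pi) ^ 3"
    using integrable_bound[of B f 0 "\<chi> i. 2 * pi"] integrable_torus_cell[OF assms(1)] assms(2)
    unfolding content_torus_cell by (metis abs_ge_zero order_trans real_norm_def)
  then show ?thesis
    by (simp add: average_def content_torus_cell abs_mult field_simps)
qed

section \<open>Translation invariance of the average\<close>

lemma periodic_shift_int:
  assumes "periodic f"
  shows "f (x + axis i (2 * pi * of_int n)) = f x"
proof -
  have nat: "f (x + axis i (2 * pi * of_nat n)) = f x" for x n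
  proof (induction n)
    case (Suc n)
    have "x + axis i (2 * pi * of_nat (Suc n)) = (x + axis i (2 * pi * of_nat n)) + axis i (2 * pi)"
      by (simp add: vec_eq_iff axis_def algebra_simps)
    then show ?case
      using Suc assms unfolding periodic_def by metis
  qed (simp add: axis_def flip: zero_vec_def)
  show ?thesis
  proof (cases "n \<ge> 0")
    case True
    then show ?thesis using nat[of x "nat n"] by simp
  next
    case False
    \<comment> \<open>A negative shift is undone by a positive one, so the natural-number case is
      applied at the shifted point.\<close>
    have "x + axis i (2 * pi * of_int n) + axis i (2 * pi * of_nat (nat (-n))) = x"
      using False by (simp add: vec_eq_iff axis_def)
    then show ?thesis
      using nat[of "x + axis i (2 * pi * of_int n)" "nat (-n)"] by (simp only:)
  qed
qed

text \<open>Cut the shifted cell at the hyperplane where coordinate \<open>i\<close> equals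
  \<open>2 * pi\<close>. Periodicity moves the part beyond it back onto the slab where that
  coordinate lies between 0 and \<open>t\<close>, and this slab completes the other part to the
  original cell.\<close>

lemma average_shift_axis_cell:
  fixes f :: "real^3 \<Rightarrow> 'b::euclidean_space"
  assumes f: "continuous_on UNIV f" "periodic f" and t: "0 \<le> t" "t \<le> 2 * pi"
  shows "average (\<lambda>x. f (x + axis i t)) = average f"
proof -
  define b :: "real^3" where "b = (\<chi> i. 2 * pi)"
  define e :: "real^3" where "e = axis i 1"
  have e: "e \<in> Basis" by (simp add: e_def)
  have axis: "axis i s = s *\<^sub>R e" for s by (simp add: e_def vec_eq_iff axis_def)
  have int: "f integrable_on cbox c d" for c d
    using f(1) continuous_on_subset integrable_continuous by blast
  have inner: "x \<bullet> e = x $ i" for x by (simp add: e_def inner_axis)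
  have nth: "e $ j = (if j = i then 1 else 0)" for j by (simp add: e_def axis_def)
  have "integral (cbox 0 b) (\<lambda>x. f (x + t *\<^sub>R e)) = integral (cbox (t *\<^sub>R e) (b + t *\<^sub>R e)) f"
    using integral_shift_cbox[of "t *\<^sub>R e" "t *\<^sub>R e" "b + t *\<^sub>R e" f] by simp
  also have "\<dots> = integral (cbox (t *\<^sub>R e) b) f + integral (cbox ((2 * pi) *\<^sub>R e) (b + t *\<^sub>R e)) f"
  proof -
    have "cbox (t *\<^sub>R e) (b + t *\<^sub>R e) \<inter> {x. x \<bullet> e \<le> 2 * pi} = cbox (t *\<^sub>R e) b"
      using t exhaust_3[of i] by (auto simp: set_eq_iff mem_box_cart b_def nth inner forall_3)
    moreover have "cbox (t *\<^sub>R e) (b + t *\<^sub>R e) \<inter> {x. x \<bullet> e \<ge> 2 * pi}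
        = cbox ((2 * pi) *\<^sub>R e) (b + t *\<^sub>R e)"
      using t exhaust_3[of i] by (auto simp: set_eq_iff mem_box_cart b_def nth inner forall_3)
    ultimately show ?thesis
      using integral_split[OF int e, of "t *\<^sub>R e" "b + t *\<^sub>R e" "2 * pi"] by simp
  qed
  also have "integral (cbox ((2 * pi) *\<^sub>R e) (b + t *\<^sub>R e)) f
      = integral (cbox 0 (b + t *\<^sub>R e - (2 * pi) *\<^sub>R e)) f"
  proof -
    have "(\<lambda>x. f (x + (2 * pi) *\<^sub>R e)) = f"
      using f(2) unfolding periodic_def axis[symmetric] by blast
    then show ?thesis
      using integral_shift_cbox[of "(2 * pi) *\<^sub>R e" "(2 * pi) *\<^sub>R e" "b + t *\<^sub>R e" f] by simp
  qed
  also have "integral (cbox (t *\<^sub>R e) b) f + integral (cbox 0 (b + t *\<^sub>R e - (2 * pi) *\<^sub>R e)) f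
      = integral (cbox 0 b) f"
  proof -
    have "cbox 0 b \<inter> {x. x \<bullet> e \<le> t} = cbox 0 (b + t *\<^sub>R e - (2 * pi) *\<^sub>R e)"
      using t exhaust_3[of i] by (auto simp: set_eq_iff mem_box_cart b_def nth inner forall_3)
    moreover have "cbox 0 b \<inter> {x. x \<bullet> e \<ge> t} = cbox (t *\<^sub>R e) b"
      using t exhaust_3[of i] by (auto simp: set_eq_iff mem_box_cart b_def nth inner forall_3)
    ultimately show ?thesis
      using integral_split[OF int e, of 0 b t] by (simp add: add.commute)
  qed
  finally show ?thesis
    by (simp add: average_def axis b_def)
qed

lemma average_shift_axis:
  fixes f :: "real^3 \<Rightarrow> 'b::euclidean_space"
  assumes f: "continuous_on UNIV f" "periodic f"
  shows "average (\<lambda>x. f (x + axis i t)) = average f"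
proof -
  define n where "n = \<lfloor>t / (2 * pi)\<rfloor>"
  define s where "s = t - 2 * pi * of_int n"
  have "of_int n \<le> t / (2 * pi)" "t / (2 * pi) < of_int n + 1"
    by (auto simp: n_def)
  then have s: "0 \<le> s" "s \<le> 2 * pi"
    by (auto simp: s_def field_simps)
  have "f (x + axis i t) = f (x + axis i s)" for x
    using periodic_shift_int[OF f(2), of "x + axis i s" i n]
    by (simp add: s_def axis_def vec_eq_iff add.assoc) (smt (verit, del_insts) plus_vec_def vec_eq_iff vec_lambda_eta vec_lambda_beta)
  then show ?thesis
    using average_shift_axis_cell[OF f s] by simp
qed

lemma average_shift:
  fixes f :: "real^3 \<Rightarrow> 'b::euclidean_space"
  assumes f: "continuous_on UNIV f" "periodic f"
  shows "average (\<lambda>x. f (x + a)) = average f"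
proof -
  have shift: "continuous_on UNIV (\<lambda>x. f (x + b))" "periodic (\<lambda>x. f (x + b))" for b
    using f(2) by (auto intro!: continuous_on_compose2[OF f(1)] continuous_intros
        simp: periodic_def add.assoc add.commute[of _ b]) (simp add: add.assoc[symmetric])
  have "average (\<lambda>x. f (x + a))
      = average (\<lambda>x. f (((x + axis 1 (a $ 1)) + axis 2 (a $ 2)) + axis 3 (a $ 3)))"
  proof -
    have "x + a = ((x + axis 1 (a $ 1)) + axis 2 (a $ 2)) + axis 3 (a $ 3)" for x
      by (simp add: vec_eq_iff forall_3 axis_def)
    then show ?thesis by (simp only:)
  qed
  also have "\<dots> = average f"
    using average_shift_axis[OF shift[of "axis 2 (a $ 2) + axis 3 (a $ 3)"]]
      average_shift_axis[OF shift[of "axis 3 (a $ 3)"]] average_shift_axis[OF f]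
    by (simp add: add.assoc)
  finally show ?thesis .
qed

section \<open>Differentiation under the integral sign and integration by parts\<close>

lemma has_derivative_convolution:
  fixes h :: "real^3 \<Rightarrow> real"
  assumes K: "continuous_on UNIV K" and h: "smooth h"
  shows "((\<lambda>x. average (\<lambda>y. K y * h (x + y))) has_derivative
      (\<lambda>v. average (\<lambda>y. K y * frechet_derivative h (at (x + y)) v))) (at x)"
proof -
  \<comment> \<open>The Leibniz rule takes the derivative of the integrand as a continuous family of
    bounded linear functions; in finite dimension continuity can be checked one direction at a
    time.\<close>
  define D where "D x y = Blinfun (\<lambda>v. K y * frechet_derivative h (at (x + y)) v)" for x y
  have hd: "(h has_derivative frechet_derivative h (at z)) (at z)" for z
    by (rule smooth_has_derivative[OF h])
  have D: "blinfun_apply (D x y) = (\<lambda>v. K y * frechet_derivative h (at (x + y)) v)" for x y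
    unfolding D_def by (rule bounded_linear_Blinfun_apply)
      (intro bounded_linear_const_mult has_derivative_bounded_linear[OF hd])
  have ch: "continuous_on UNIV h" by (rule smooth_continuous[OF h])
  have cd: "continuous_on UNIV (\<lambda>z. frechet_derivative h (at z) v)" for v
    by (intro smooth_continuous smooth_derivative h)
  have int: "(\<lambda>y. K y * h (x + y)) integrable_on torus_cell" for x
    by (intro integrable_torus_cell continuous_intros K continuous_on_compose2[OF ch]) auto
  have cont: "continuous_on (UNIV \<times> torus_cell) (\<lambda>(x, y). D x y)"
    by (rule continuous_on_blinfun_componentwise)
      (auto simp: D split_beta intro!: continuous_intros continuous_on_compose2[OF K]
        continuous_on_compose2[OF cd])
  have "((\<lambda>x. integral torus_cell (\<lambda>y. K y * h (x + y))) has_derivative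
      integral torus_cell (D x)) (at x within UNIV)"
  proof (rule leibniz_rule[OF _ int cont])
    fix x y :: "real^3"
    have "((\<lambda>x. x + y) has_derivative (\<lambda>v. v)) (at x)"
      by (auto intro!: derivative_eq_intros)
    from has_derivative_compose[OF this hd]
    show "((\<lambda>x. K y * h (x + y)) has_derivative blinfun_apply (D x y)) (at x within UNIV)"
      unfolding D by (auto intro!: derivative_eq_intros)
  qed auto
  moreover have "blinfun_apply (integral torus_cell (D x)) = (\<lambda>v. integral torus_cell (\<lambda>y. K y * frechet_derivative h (at (x + y)) v))"
  proof
    fix v
    have "continuous_on torus_cell (D x)"
      using continuous_on_compose2[OF cont, of torus_cell "\<lambda>y. (x, y)"]
      by (auto simp: continuous_on_Pair)
    then show "blinfun_apply (integral torus_cell (D x)) v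
        = integral torus_cell (\<lambda>y. K y * frechet_derivative h (at (x + y)) v)"
      using blinfun_apply_integral[OF integrable_continuous, of "0" "\<chi> i. 2 * pi" "D x" v]
      by (simp add: D)
  qed
  ultimately show ?thesis
    unfolding average_def by (intro has_derivative_scaleR_right) simp
qed

definition convolution :: "(real^3 \<Rightarrow> real) \<Rightarrow> (real^3 \<Rightarrow> real) \<Rightarrow> real^3 \<Rightarrow> real"
  where "convolution K h x = average (\<lambda>y. K y * h (x + y))"

text \<open>A directional derivative of the convolution is the convolution of \<open>K\<close> with
  a derivative of \<open>h\<close>, so induction on the order works once \<open>h\<close> is
  generalised.\<close>

lemma smooth_convolution:
  assumes K: "continuous_on UNIV K" and h: "smooth h"
  shows "smooth (convolution K h)"
proof -
  have "Ck n (convolution K h)" if "smooth h" for n h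
    using that
  proof (induction n arbitrary: h)
    case 0
    have "isCont (convolution K h) x" for x
      using has_derivative_continuous[OF has_derivative_convolution[OF K 0]]
      by (simp add: convolution_def[abs_def])
    then show ?case
      by (simp add: continuous_on_eq_continuous_within)
  next
    case (Suc n)
    have "Ck n (\<lambda>x. average (\<lambda>y. K y * frechet_derivative h (at (x + y)) v))" for v
      using Suc.IH[OF smooth_derivative[OF Suc.prems, of v]] by (simp add: convolution_def[abs_def])
    then show ?case
      unfolding convolution_def[abs_def]
      by (rule Ck_SucI[OF has_derivative_convolution[OF K Suc.prems]])
  qed
  then show ?thesis
    using h by (simp add: smooth_def[of "convolution K h"])
qed

lemma partial_convolution:
  assumes "continuous_on UNIV K" "smooth h"
  shows "partial i (convolution K h) x = convolution K (partial i h) x"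
  unfolding partial_def convolution_def[abs_def]
  by (subst frechet_derivative_eqI[OF has_derivative_convolution[OF assms]]) simp

lemma periodic_convolution:
  assumes "periodic h"
  shows "periodic (convolution K h)"
proof -
  have "h (x + axis i (2 * pi) + y) = h (x + y)" for x y i
    using assms unfolding periodic_def by (metis add.assoc add.commute)
  then show ?thesis
    by (simp add: periodic_def convolution_def)
qed

text \<open>By translation invariance, convolution with the kernel 1 gives a constant function; its
  derivative at 0 is the average of \<open>partial i f\<close>.\<close>

lemma average_partial:
  assumes f: "smooth f" "periodic f"
  shows "average (partial i f) = (0::real)"
proof -
  have "convolution (\<lambda>_. 1) f = (\<lambda>x. average f)"
    using average_shift[OF smooth_continuous[OF f(1)] f(2)]
    by (auto simp: convolution_def add.commute)
  then have "convolution (\<lambda>_. 1) (partial i f) 0 = 0"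
    by (simp flip: partial_convolution[OF continuous_on_const f(1)] add: partial_const)
  then show ?thesis
    by (simp add: convolution_def)
qed

lemma smooth_mult: "smooth f \<Longrightarrow> smooth g \<Longrightarrow> smooth (\<lambda>x. f x * g x)"
  for f g :: "'a::euclidean_space \<Rightarrow> real"
  by (rule smooth_bilinear[OF bounded_bilinear_mult])

lemma average_by_parts:
  fixes f g :: "real^3 \<Rightarrow> real"
  assumes f: "smooth f" "periodic f" and g: "smooth g" "periodic g"
  shows "average (\<lambda>x. f x * partial i g x) = - average (\<lambda>x. partial i f x * g x)"
proof -
  have "periodic (\<lambda>x. f x * g x)"
    using f g by (simp add: periodic_def)
  then have "0 = average (\<lambda>x. partial i (\<lambda>x. f x * g x) x)"
    using average_partial[OF smooth_mult[OF f(1) g(1)]] by simp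
  also have "\<dots> = average (\<lambda>x. f x * partial i g x) + average (\<lambda>x. partial i f x * g x)"
    by (simp add: partial_mult f g average_add smooth_continuous smooth_mult smooth_partial)
  finally show ?thesis by simp
qed

section \<open>From the cell to all points\<close>

lemma periodic_representative:
  assumes "periodic f"
  obtains y where "y \<in> torus_cell" "f y = f x"
proof -
  define n where "n i = - \<lfloor>x $ i / (2 * pi)\<rfloor>" for i
  define y where "y = x + axis 1 (2 * pi * of_int (n 1)) + axis 2 (2 * pi * of_int (n 2))
    + axis 3 (2 * pi * of_int (n 3))"
  have "y $ i = x $ i + 2 * pi * of_int (n i)" for i
    using exhaust_3[of i] by (auto simp: y_def axis_def)
  moreover have "0 \<le> x $ i + 2 * pi * of_int (n i)" "x $ i + 2 * pi * of_int (n i) \<le> 2 * pi" for i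
  proof -
    have "of_int (- n i) \<le> x $ i / (2 * pi)" "x $ i / (2 * pi) < of_int (- n i) + 1"
      by (auto simp: n_def)
    then show "0 \<le> x $ i + 2 * pi * of_int (n i)" "x $ i + 2 * pi * of_int (n i) \<le> 2 * pi"
      by (auto simp: field_simps)
  qed
  ultimately have "y \<in> torus_cell"
    by (simp add: mem_box_cart)
  moreover have "f y = f x"
    by (simp only: y_def periodic_shift_int[OF assms])
  ultimately show thesis by (rule that)
qed

lemma periodic_bounded:
  fixes f :: "real^3 \<Rightarrow> real"
  assumes "continuous_on UNIV f" "periodic f"
  obtains B where "\<And>x. \<bar>f x\<bar> \<le> B"
proof -
  have "bounded (f ` torus_cell)"
    using assms(1) by (intro compact_imp_bounded compact_continuous_image) (auto intro: continuous_on_subset)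
  then obtain B where "\<And>y. y \<in> torus_cell \<Longrightarrow> \<bar>f y\<bar> \<le> B"
    by (auto simp: bounded_iff)
  then show thesis
    using periodic_representative[OF assms(2)] that by metis
qed

text \<open>Boundary points of the cell are limits of interior ones. This lets the uniqueness
  argument work at a point that keeps a positive distance from all faces.\<close>

lemma periodic_eq_0:
  fixes f :: "real^3 \<Rightarrow> real"
  assumes f: "continuous_on UNIV f" "periodic f"
    and 0: "\<And>x. (\<And>i. 0 < x $ i \<and> x $ i < 2 * pi) \<Longrightarrow> f x = 0"
  shows "f x = 0"
proof -
  have "(\<chi> i. pi) \<in> box (0::real^3) (\<chi> i. 2 * pi)"
    by (simp add: mem_box_cart)
  then have cl: "closure (box (0::real^3) (\<chi> i. 2 * pi)) = torus_cell"
    by (intro closure_box) blast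
  obtain y where y: "y \<in> torus_cell" "f y = f x"
    using periodic_representative[OF f(2)] .
  have "f y = 0"
    by (rule continuous_constant_on_closure[of "box 0 (\<chi> i. 2 * pi)"])
      (use f(1) 0 y(1) in \<open>auto simp: cl mem_box_cart intro: continuous_on_subset\<close>)
  then show ?thesis using y by simp
qed

lemma average_eq_0D:
  fixes f :: "real^3 \<Rightarrow> real"
  assumes f: "continuous_on UNIV f" "periodic f" "\<And>x. 0 \<le> f x" "average f = 0"
  shows "f x = 0"
proof -
  have int: "(f has_integral 0) torus_cell"
    using integrable_integral[OF integrable_torus_cell[OF f(1)]] f(4) by (simp add: average_def)
  obtain y where y: "y \<in> torus_cell" "f y = f x"
    using periodic_representative[OF f(2)] .
  have "(\<chi> i. pi) \<in> box (0::real^3) (\<chi> i. 2 * pi)"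
    by (simp add: mem_box_cart)
  then have "f y = 0"
    by (intro has_integral_0_cbox_imp_0[OF _ _ int _ y(1)])
      (use f in \<open>auto intro: continuous_on_subset\<close>)
  then show ?thesis using y by simp
qed


section \<open>Trigonometric waves\<close>

definition freq :: "int^3 \<Rightarrow> real^3"
  where "freq k = (\<chi> i. of_int (k $ i))"

text \<open>The phase \<open>c\<close> replaces complex exponentials: it covers cosine and sine at
  once, and differentiation only adds \<open>pi / 2\<close> to it, up to a factor from the
  frequency.\<close>

definition wave :: "int^3 \<Rightarrow> real \<Rightarrow> real^3 \<Rightarrow> real"
  where "wave k c x = cos (freq k \<bullet> x + c)"

lemma freq_nth [simp]: "freq k $ i = of_int (k $ i)"
  by (simp add: freq_def)

lemma freq_add: "freq (k + l) = freq k + freq l"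
  and freq_diff: "freq (k - l) = freq k - freq l"
  and freq_minus: "freq (- k) = - freq k"
  and freq_0 [simp]: "freq 0 = 0"
  by (simp_all add: vec_eq_iff)

lemma wave_has_derivative:
  "(wave k c has_derivative (\<lambda>v. wave k (c + pi / 2) x * (freq k \<bullet> v))) (at x)"
proof -
  have "cos (freq k \<bullet> x + (c + pi / 2)) = - sin (freq k \<bullet> x + c)"
    by (simp add: cos_add sin_add algebra_simps)
  then show ?thesis
    unfolding wave_def[abs_def] by (auto intro!: derivative_eq_intros)
qed

lemma smooth_wave: "smooth (wave k c)"
proof -
  have "Ck n (wave k c)" for n
  proof (induction n arbitrary: c)
    case 0
    then show ?case
      by (auto simp: wave_def[abs_def] intro!: continuous_intros)
  next
    case (Suc n)
    have "Ck n (\<lambda>x. wave k (c + pi / 2) x * (freq k \<bullet> v))" for v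
      by (rule Ck_linear[OF bounded_linear_mult_left Suc])
    then show ?case
      by (rule Ck_SucI[OF wave_has_derivative])
  qed
  then show ?thesis by (simp add: smooth_def)
qed

lemma continuous_wave: "continuous_on UNIV (wave k c)"
  by (rule smooth_continuous[OF smooth_wave])

lemma partial_wave: "partial i (wave k c) x = of_int (k $ i) * wave k (c + pi / 2) x"
  unfolding partial_def
  by (subst frechet_derivative_eqI[OF wave_has_derivative]) (simp add: inner_axis)

lemma periodic_wave: "periodic (wave k c)"
proof -
  have "cos (t + 2 * pi * of_int n) = cos t" for t n
    by (simp add: cos_add)
  then have "cos (freq k \<bullet> x + c + 2 * pi * of_int (k $ i)) = cos (freq k \<bullet> x + c)" for x i
    by blast
  then show ?thesis
    by (simp add: periodic_def wave_def inner_add_right inner_axis algebra_simps)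
qed

lemma abs_wave_le_1: "\<bar>wave k c x\<bar> \<le> 1"
  by (simp add: wave_def)

text \<open>If \<open>k $ i\<close> is nonzero, the wave is a multiple of the derivative of
  \<open>wave k (c - pi / 2)\<close>, and derivatives average to zero.\<close>

lemma average_wave: "average (wave k c) = (if k = 0 then cos c else 0)"
proof (cases "k = 0")
  case True
  then show ?thesis
    by (simp add: wave_def[abs_def] average_const)
next
  case False
  then obtain i where i: "k $ i \<noteq> 0"
    by (auto simp: vec_eq_iff)
  have "of_int (k $ i) * average (wave k c) = average (partial i (wave k (c - pi / 2)))"
    by (simp add: partial_wave[abs_def] average_mult continuous_wave)
  also have "\<dots> = 0"
    by (rule average_partial[OF smooth_wave periodic_wave])
  finally show ?thesis using i False by simp
qed

lemma wave_mult:
  "wave k c x * wave l d x = (wave (k + l) (c + d) x + wave (k - l) (c - d) x) / 2"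
  by (simp add: wave_def cos_times_cos freq_add freq_diff inner_add_left inner_diff_left algebra_simps)

text \<open>The two cases are added and not made exclusive, because \<open>k = - l\<close> and
  \<open>k = l\<close> hold together when both frequencies vanish.\<close>

lemma average_wave_mult:
  "average (\<lambda>x. wave k c x * wave l d x)
    = ((if k = - l then cos (c + d) else 0) + (if k = l then cos (c - d) else 0)) / 2"
proof -
  have "average (\<lambda>x. wave k c x * wave l d x)
      = average (\<lambda>x. (1/2) * (wave (k + l) (c + d) x + wave (k - l) (c - d) x))"
    by (simp add: wave_mult)
  also have "\<dots> = (1/2) * (average (wave (k + l) (c + d)) + average (wave (k - l) (c - d)))"
    by (subst average_mult) (auto intro!: continuous_on_add continuous_wave simp: average_add continuous_wave)
  finally show ?thesis
    by (simp add: average_wave eq_neg_iff_add_eq_0)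
qed

section \<open>Fourier multipliers and the decay of coefficients\<close>

text \<open>This is the operator \<open>1 - \<partial>\<^sub>i\<^sup>2\<close>. Its multiplier
  \<open>1 + (k $ i)\<^sup>2\<close> never vanishes, unlike that of the Laplacian, so it can be
  divided by at every frequency.\<close>

definition bessel :: "3 \<Rightarrow> (real^3 \<Rightarrow> real) \<Rightarrow> real^3 \<Rightarrow> real"
  where "bessel i f x = f x - partial i (partial i f) x"

definition laplacian :: "(real^3 \<Rightarrow> real) \<Rightarrow> real^3 \<Rightarrow> real"
  where "laplacian f x = (\<Sum>i\<in>UNIV. partial i (partial i f) x)"

lemma smooth_bessel: "smooth f \<Longrightarrow> smooth (bessel i f)"
  unfolding bessel_def[abs_def] by (intro smooth_diff smooth_partial)

lemma periodic_bessel: "smooth f \<Longrightarrow> periodic f \<Longrightarrow> periodic (bessel i f)"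
  using periodic_partial[OF smooth_partial periodic_partial]
  by (simp add: bessel_def[abs_def] periodic_def)

lemma smooth_laplacian: "smooth f \<Longrightarrow> smooth (laplacian f)"
  unfolding laplacian_def[abs_def] by (intro smooth_sum smooth_partial)

lemma periodic_laplacian: "smooth f \<Longrightarrow> periodic f \<Longrightarrow> periodic (laplacian f)"
  using periodic_partial[OF smooth_partial periodic_partial, of f]
  unfolding laplacian_def[abs_def] periodic_def by simp

text \<open>Integrate by parts twice. The two signs cancel; the remaining minus comes from the
  accumulated phase shift by \<open>pi\<close>.\<close>

lemma average_wave_second_partial:
  assumes f: "smooth f" "periodic f"
  shows "average (\<lambda>y. wave k c y * partial i (partial i f) y)
    = - (of_int (k $ i))\<^sup>2 * average (\<lambda>y. wave k c y * f y)"
proof -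
  have shift: "wave k (pi + c) y = - wave k c y" for y
    using cos_periodic_pi[of "freq k \<bullet> y + c"] by (simp add: wave_def add_ac)
  have "average (\<lambda>y. wave k c y * partial i (partial i f) y)
      = - average (\<lambda>y. of_int (k $ i) * (wave k (c + pi / 2) y * partial i f y))"
    by (subst average_by_parts)
      (simp_all add: smooth_wave periodic_wave smooth_partial periodic_partial f partial_wave mult.assoc)
  also have "\<dots> = - of_int (k $ i) * average (\<lambda>y. wave k (c + pi / 2) y * partial i f y)"
    by (simp add: average_mult smooth_continuous smooth_mult smooth_wave smooth_partial f)
  also have "average (\<lambda>y. wave k (c + pi / 2) y * partial i f y)
      = average (\<lambda>y. of_int (k $ i) * (wave k c y * f y))"
  proof -
    have "average (\<lambda>y. wave k (c + pi / 2) y * partial i f y)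
        = - average (\<lambda>y. - (of_int (k $ i) * (wave k c y * f y)))"
      by (subst average_by_parts)
        (simp_all add: smooth_wave periodic_wave f partial_wave shift mult.assoc)
    also have "\<dots> = average (\<lambda>y. of_int (k $ i) * (wave k c y * f y))"
      by (subst average_linear[OF bounded_linear_minus[OF bounded_linear_ident]])
        (auto intro!: smooth_continuous smooth_mult smooth_wave smooth_const f)
    finally show ?thesis .
  qed
  also have "\<dots> = of_int (k $ i) * average (\<lambda>y. wave k c y * f y)"
    by (simp add: average_mult smooth_continuous smooth_mult smooth_wave f)
  finally show ?thesis
    by (simp add: power2_eq_square)
qed

lemma average_wave_bessel:
  assumes f: "smooth f" "periodic f"
  shows "average (\<lambda>y. wave k c y * bessel i f y)
    = (1 + (of_int (k $ i))\<^sup>2) * average (\<lambda>y. wave k c y * f y)"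
proof -
  have "average (\<lambda>y. wave k c y * bessel i f y)
      = average (\<lambda>y. wave k c y * f y) - average (\<lambda>y. wave k c y * partial i (partial i f) y)"
    by (simp add: bessel_def right_diff_distrib average_diff smooth_continuous smooth_mult
        smooth_wave smooth_partial f)
  then show ?thesis
    by (simp add: average_wave_second_partial f algebra_simps)
qed

lemma average_wave_laplacian:
  assumes f: "smooth f" "periodic f"
  shows "average (\<lambda>y. wave k c y * laplacian f y)
    = - (norm (freq k))\<^sup>2 * average (\<lambda>y. wave k c y * f y)"
proof -
  have "average (\<lambda>y. wave k c y * laplacian f y)
      = (\<Sum>i\<in>UNIV. average (\<lambda>y. wave k c y * partial i (partial i f) y))"
    by (simp add: laplacian_def sum_distrib_left average_sum smooth_continuous smooth_mult
        smooth_wave smooth_partial f)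
  also have "\<dots> = - (norm (freq k))\<^sup>2 * average (\<lambda>y. wave k c y * f y)"
    unfolding power2_norm_eq_inner
    by (simp add: average_wave_second_partial f inner_vec_def power2_eq_square
        sum_distrib_right sum_negf)
  finally show ?thesis .
qed

definition bessel3 :: "(real^3 \<Rightarrow> real) \<Rightarrow> real^3 \<Rightarrow> real"
  where "bessel3 f = bessel 1 (bessel 2 (bessel 3 f))"

text \<open>The multiplier of \<open>bessel3\<close>. Having one quadratic factor per coordinate
  makes the lattice sum of its reciprocals split into three one-dimensional series.\<close>

definition weight :: "int^3 \<Rightarrow> real"
  where "weight k = (\<Prod>i\<in>UNIV. 1 + (of_int (k $ i))\<^sup>2)"

lemma weight_ge_1: "1 \<le> weight k"
  unfolding weight_def by (rule prod_ge_1) simp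

lemma weight_eq:
  "weight k = (1 + (of_int (k $ 1))\<^sup>2) * ((1 + (of_int (k $ 2))\<^sup>2) * (1 + (of_int (k $ 3))\<^sup>2))"
  unfolding weight_def UNIV_3 by simp

lemma smooth_bessel3: "smooth f \<Longrightarrow> smooth (bessel3 f)"
  by (simp add: bessel3_def smooth_bessel)

lemma periodic_bessel3: "smooth f \<Longrightarrow> periodic f \<Longrightarrow> periodic (bessel3 f)"
  by (simp add: bessel3_def smooth_bessel periodic_bessel)

lemma average_wave_bessel3:
  assumes f: "smooth f" "periodic f"
  shows "average (\<lambda>y. wave k c y * bessel3 f y) = weight k * average (\<lambda>y. wave k c y * f y)"
  unfolding bessel3_def weight_eq
  by (simp add: average_wave_bessel smooth_bessel periodic_bessel f mult.assoc)

lemma summable_inverse_weight: "(\<lambda>k. 1 / weight k) summable_on UNIV"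
proof -
  define q :: "int \<Rightarrow> real" where "q n = 1 / (1 + (of_int n)\<^sup>2)" for n
  have q: "0 \<le> q n" for n by (simp add: q_def)
  have nat: "(\<lambda>n. q (int n)) summable_on UNIV"
  proof -
    have "summable (\<lambda>n. 2 * (1 / (real (Suc n))\<^sup>2))"
      using inverse_power_summable[of 2, where 'a = real] summable_Suc_iff[of "\<lambda>n. inverse (real n ^ 2)"]
      by (intro summable_mult) (auto simp: inverse_eq_divide)
    then have "summable (\<lambda>n. q (int n))"
    proof (rule summable_comparison_test'[where N = 0])
      fix n :: nat
      \<comment> \<open>Equivalent to \<open>0 \<le> (n - 1)\<^sup>2\<close>. Comparing with the
        successor keeps the majorant meaningful at \<open>n = 0\<close>.\<close>
      have "(real (Suc n))\<^sup>2 \<le> 2 * (1 + (real n)\<^sup>2)"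
        using zero_le_power2[of "real n - 1"] by (simp add: power2_eq_square algebra_simps)
      moreover have "0 < 1 + (real n)\<^sup>2"
        by (simp add: add_pos_nonneg)
      ultimately show "norm (q (int n)) \<le> 2 * (1 / (real (Suc n))\<^sup>2)"
        by (simp add: q_def field_simps)
    qed
    then show ?thesis
      by (intro summable_nonneg_imp_summable_on q)
  qed
  \<comment> \<open>The integers are covered by two copies of the naturals. They overlap in 0, which
    is harmless for summability.\<close>
  have "q summable_on range int"
    using nat by (subst summable_on_reindex) (auto simp: o_def inj_on_def)
  moreover have "q summable_on range (\<lambda>n. - int n)"
    using nat by (subst summable_on_reindex) (auto simp: o_def inj_on_def q_def)
  ultimately have "q summable_on (range int \<union> range (\<lambda>n. - int n))"
    by (rule summable_on_union)
  moreover have "range int \<union> range (\<lambda>n. - int n) = UNIV"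
    by (auto, metis int_cases2 range_eqI)
  ultimately have Q: "q summable_on UNIV" by simp
  have prod: "(\<lambda>(a, b). f a * g b) summable_on UNIV"
    if "f summable_on UNIV" "g summable_on UNIV" "\<And>a. 0 \<le> f a" "\<And>b. 0 \<le> g b"
    for f :: "'a \<Rightarrow> real" and g :: "'b \<Rightarrow> real"
  proof -
    have "(\<lambda>z. norm (f (fst z) * g (snd z))) summable_on (UNIV \<times> UNIV)"
      unfolding Infinite_Sum.abs_summable_on_Sigma_iff
      using that by (auto simp: abs_mult infsum_cmult_right' infsum_nonneg intro!: summable_on_cmult_left summable_on_cmult_right)
    then show ?thesis
      using Infinite_Sum.abs_summable_summable by (force simp: split_beta)
  qed
  have "(\<lambda>(a, b, c). q a * (q b * q c)) summable_on UNIV"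
    using prod[OF Q prod[OF Q Q]] q by (simp add: case_prod_unfold)
  moreover have "bij (\<lambda>k::int^3. (k $ 1, k $ 2, k $ 3))"
    by (rule bijI) (auto simp: inj_on_def vec_eq_iff forall_3 image_iff, metis vector_3)
  ultimately have "(\<lambda>k::int^3. q (k $ 1) * (q (k $ 2) * q (k $ 3))) summable_on UNIV"
    using summable_on_reindex_bij_betw[of "\<lambda>k::int^3. (k $ 1, k $ 2, k $ 3)" UNIV UNIV
        "\<lambda>(a, b, c). q a * (q b * q c)"] by simp
  then show ?thesis
    by (simp add: q_def weight_eq)
qed

section \<open>Exchanging averages with each other and with infinite sums\<close>

lemma average_mono:
  fixes f g :: "real^3 \<Rightarrow> real"
  assumes "continuous_on UNIV f" "continuous_on UNIV g" "\<And>x. x \<in> torus_cell \<Longrightarrow> f x \<le> g x"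
  shows "average f \<le> average g"
  unfolding average_def using assms
  by (intro scaleR_left_mono integral_le integrable_torus_cell) auto

lemma average_swap:
  fixes F :: "real^3 \<Rightarrow> real^3 \<Rightarrow> real"
  assumes "continuous_on UNIV (\<lambda>(x, y). F x y)"
  shows "average (\<lambda>x. average (\<lambda>y. F x y)) = average (\<lambda>y. average (\<lambda>x. F x y))"
  using integral_swap_continuous[of 0 0 "\<chi> i. 2 * pi" "\<chi> i. 2 * pi" F]
    continuous_on_subset[OF assms]
  by (simp add: average_def)

lemma continuous_infsum:
  fixes f :: "'k \<Rightarrow> real^3 \<Rightarrow> real"
  assumes f: "\<And>k. k \<in> A \<Longrightarrow> continuous_on UNIV (f k)"
    and M: "\<And>k x. k \<in> A \<Longrightarrow> \<bar>f k x\<bar> \<le> M k" "M summable_on A"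
  shows "continuous_on UNIV (\<lambda>x. \<Sum>\<^sub>\<infinity>k\<in>A. f k x)"
proof (rule uniform_limit_theorem)
  show "uniform_limit UNIV (\<lambda>X x. \<Sum>k\<in>X. f k x) (\<lambda>x. \<Sum>\<^sub>\<infinity>k\<in>A. f k x) (finite_subsets_at_top A)"
    by (rule Weierstrass_m_test_general[OF _ M(2)]) (simp add: M(1))
  show "\<forall>\<^sub>F X in finite_subsets_at_top A. continuous_on UNIV (\<lambda>x. \<Sum>k\<in>X. f k x)"
    by (rule eventually_finite_subsets_at_top_weakI) (auto intro!: continuous_on_sum f)
qed simp

lemma has_sum_average:
  fixes f :: "'k \<Rightarrow> real^3 \<Rightarrow> real"
  assumes f: "\<And>k. k \<in> A \<Longrightarrow> continuous_on UNIV (f k)"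
    and M: "\<And>k x. k \<in> A \<Longrightarrow> \<bar>f k x\<bar> \<le> M k" "M summable_on A"
  shows "((\<lambda>k. average (f k)) has_sum average (\<lambda>x. \<Sum>\<^sub>\<infinity>k\<in>A. f k x)) A"
  unfolding has_sum_def
proof (rule tendstoI)
  let ?S = "\<lambda>x. \<Sum>\<^sub>\<infinity>k\<in>A. f k x"
  fix e :: real assume e: "0 < e"
  have "uniform_limit UNIV (\<lambda>X x. \<Sum>k\<in>X. f k x) ?S (finite_subsets_at_top A)"
    by (rule Weierstrass_m_test_general[OF _ M(2)]) (simp add: M(1))
  \<comment> \<open>Half of \<open>e\<close>, since averaging turns the strict pointwise bound into
    a weak one.\<close>
  then have "\<forall>\<^sub>F X in finite_subsets_at_top A. \<forall>x\<in>UNIV. dist (\<Sum>k\<in>X. f k x) (?S x) < e / 2"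
    using e by (intro uniform_limitD) auto
  moreover have "\<forall>\<^sub>F X in finite_subsets_at_top A. finite X \<and> X \<subseteq> A"
    by (rule eventually_finite_subsets_at_top_weakI) auto
  ultimately show "\<forall>\<^sub>F X in finite_subsets_at_top A.
      dist (\<Sum>k\<in>X. average (f k)) (average ?S) < e"
  proof eventually_elim
    case (elim X)
    have c: "continuous_on UNIV (f k)" if "k \<in> X" for k
      using f elim that by auto
    then have c': "continuous_on UNIV (\<lambda>x. \<Sum>k\<in>X. f k x)"
      by (intro continuous_on_sum)
    note S = continuous_infsum[of A f M, OF f M]
    have "\<bar>average (\<lambda>x. (\<Sum>k\<in>X. f k x) - ?S x)\<bar> \<le> e / 2"
      using elim by (intro average_abs_le continuous_on_diff c' S) (auto simp: dist_real_def less_imp_le)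
    then show ?case
      using e by (simp add: average_diff[OF c' S] average_sum[OF c] dist_real_def)
  qed
qed


section \<open>Fourier inversion\<close>

text \<open>The test functions of the uniqueness argument. Orthogonality to waves extends to them by
  linearity, and they are closed under products, hence contain all powers of
  \<open>peak y\<close>.\<close>

inductive trig_poly :: "(real^3 \<Rightarrow> real) \<Rightarrow> bool" where
  trig_wave: "trig_poly (wave k c)"
| trig_add: "trig_poly p \<Longrightarrow> trig_poly q \<Longrightarrow> trig_poly (\<lambda>x. p x + q x)"
| trig_cmult: "trig_poly p \<Longrightarrow> trig_poly (\<lambda>x. a * p x)"

lemma trig_poly_continuous: "trig_poly p \<Longrightarrow> continuous_on UNIV p"
  by (induction rule: trig_poly.induct) (auto intro!: continuous_wave continuous_intros)

lemma trig_poly_const: "trig_poly (\<lambda>x. a)"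
  using trig_cmult[OF trig_wave[of 0 0], of a] by (simp add: wave_def)

lemma trig_poly_mult:
  assumes "trig_poly p" "trig_poly q"
  shows "trig_poly (\<lambda>x. p x * q x)"
  using assms
proof (induction p rule: trig_poly.induct)
  case (trig_wave k c)
  from trig_wave show ?case
  proof (induction q rule: trig_poly.induct)
    case (trig_wave l d)
    have "trig_poly (\<lambda>x. (1 / 2) * (wave (k + l) (c + d) x + wave (k - l) (c - d) x))"
      by (intro trig_poly.intros)
    then show ?case by (simp add: wave_mult)
  next
    case (trig_add p q)
    then show ?case using trig_poly.trig_add by (simp add: distrib_left)
  next
    case (trig_cmult p a)
    then show ?case using trig_poly.trig_cmult[of _ a] by (simp add: mult.left_commute)
  qed
next
  case (trig_add p q)
  then show ?case using trig_poly.trig_add by (simp add: distrib_right)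
next
  case (trig_cmult p a)
  then show ?case using trig_poly.trig_cmult[of _ a] by (simp add: mult.assoc)
qed

lemma trig_poly_power: "trig_poly p \<Longrightarrow> trig_poly (\<lambda>x. p x ^ n)"
  by (induction n) (auto intro: trig_poly_const trig_poly_mult)

lemma average_trig_poly_eq_0:
  assumes "trig_poly p" "continuous_on UNIV g"
    and 0: "\<And>k c. average (\<lambda>x. wave k c x * g x) = 0"
  shows "average (\<lambda>x. p x * g x) = 0"
  using assms(1)
proof (induction p rule: trig_poly.induct)
  case (trig_add p q)
  then have "average (\<lambda>x. p x * g x + q x * g x) = 0"
    by (subst average_add) (auto intro!: continuous_on_mult assms(2) dest: trig_poly_continuous)
  then show ?case by (simp add: distrib_right)
next
  case (trig_cmult p a)
  then have "average (\<lambda>x. a * (p x * g x)) = 0"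
    by (subst average_mult) (auto intro!: continuous_on_mult assms(2) dest: trig_poly_continuous)
  then show ?case by (simp add: mult.assoc)
qed (rule 0)

text \<open>Each factor is the squared cosine of half the coordinate difference, so the value 1 is
  attained exactly at \<open>y\<close> modulo the periods. The powers are unnormalised products of
  de la Vallee Poussin kernels.\<close>

definition peak :: "real^3 \<Rightarrow> real^3 \<Rightarrow> real"
  where "peak y x = ((1 + cos (x $ 1 - y $ 1)) / 2) * ((1 + cos (x $ 2 - y $ 2)) / 2)
    * ((1 + cos (x $ 3 - y $ 3)) / 2)"

lemma trig_poly_peak: "trig_poly (peak y)"
proof -
  have w: "wave (axis i 1) (- (y $ i)) x = cos (x $ i - y $ i)" for i x
  proof -
    have "freq (axis i 1) = axis i 1"
      by (simp add: vec_eq_iff axis_def)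
    then show ?thesis
      by (simp add: wave_def inner_axis inner_commute)
  qed
  have "trig_poly (\<lambda>x. (1 / 2) * (1 + wave (axis i 1) (- (y $ i)) x))" for i
    by (intro trig_poly.intros trig_poly_const)
  then have "trig_poly (\<lambda>x. (1 + cos (x $ i - y $ i)) / 2)" for i
    by (simp add: w)
  then show ?thesis
    unfolding peak_def[abs_def] by (intro trig_poly_mult)
qed

text \<open>All three factors lie between 0 and 1, so any single one bounds the product; one
  coordinate away from \<open>y\<close> is enough to make the peak small.\<close>

lemma peak_nonneg: "0 \<le> peak y x" and peak_le_1: "peak y x \<le> 1"
  and peak_le: "peak y x \<le> (1 + cos (x $ i - y $ i)) / 2"
proof -
  define c where "c i = (1 + cos (x $ i - y $ i)) / 2" for i
  have c: "0 \<le> c i" "c i \<le> 1" for i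
    using cos_ge_minus_one[of "x $ i - y $ i"] unfolding c_def by (simp_all, linarith)
  have p: "peak y x = c 1 * c 2 * c 3"
    by (simp add: peak_def c_def)
  have 12: "0 \<le> c 1 * c 2" "c 1 * c 2 \<le> c 1" "c 1 * c 2 \<le> c 2"
    using mult_left_le[of "c 2" "c 1"] mult_right_le_one_le[of "c 1" "c 2"] mult_left_le[of "c 1" "c 2"] c
    by (auto simp: mult.commute)
  show "0 \<le> peak y x"
    by (simp add: p c)
  have "peak y x \<le> c 1 * c 2" "peak y x \<le> c 3"
    using mult_left_le[of "c 3" "c 1 * c 2"] mult_left_le[of "c 1 * c 2" "c 3"] 12 c[of 1] c[of 2] c[of 3]
    by (auto simp: p mult.commute)
  then have "peak y x \<le> c i" for i
    using 12 exhaust_3[of i] by auto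
  then show "peak y x \<le> (1 + cos (x $ i - y $ i)) / 2" "peak y x \<le> 1"
    using c(2)[of 1] order_trans[of "peak y x" "c 1" 1] by (simp_all only: c_def)
qed

lemma periodic_peak: "periodic (peak y)"
proof -
  have "cos (x $ j + axis i (2 * pi) $ j - y $ j) = cos (x $ j - y $ j)" for x i j
    using cos_periodic[of "x $ j - y $ j"] by (auto simp: axis_def algebra_simps)
  then show ?thesis
    by (simp add: periodic_def peak_def)
qed

text \<open>
  If \<open>g y \<noteq> 0\<close>, then the averages of \<open>g\<close> against the powers of \<open>peak y\<close>, which concentrate
  at \<open>y\<close>, do not all vanish.
\<close>

lemma orthogonal_to_waves_imp_zero:
  fixes g :: "real^3 \<Rightarrow> real"
  assumes g: "continuous_on UNIV g" "periodic g"
    and orth: "\<And>k c. average (\<lambda>x. wave k c x * g x) = 0"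
  shows "g x = 0"
proof (rule periodic_eq_0[OF g])
  fix y :: "real^3"
  assume y: "\<And>i. 0 < y $ i \<and> y $ i < 2 * pi"
  show "g y = 0"
  proof (rule ccontr)
    assume "g y \<noteq> 0"
    \<comment> \<open>Multiplying by the sign makes the value at \<open>y\<close> positive, equal to
      \<open>2 * e\<close>, so \<open>G\<close> exceeds \<open>e\<close> near
      \<open>y\<close>.\<close>
    define G where "G x = sgn (g y) * g x" for x
    define e where "e = \<bar>g y\<bar> / 2"
    have e: "0 < e" "G y = 2 * e"
      using \<open>g y \<noteq> 0\<close> by (simp_all add: G_def e_def sgn_mult_self_eq abs_sgn_eq sgn_if)
    have G: "continuous_on UNIV G"
      unfolding G_def by (intro continuous_intros g)
    obtain B where B: "\<And>x. \<bar>g x\<bar> \<le> B"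
      using periodic_bounded[OF g] by blast
    then have B0: "0 \<le> B" using abs_ge_zero order_trans by blast
    have GB: "\<bar>G x\<bar> \<le> B" for x
      using B[of x] B0 by (simp add: G_def abs_mult abs_sgn_eq)
    have "\<exists>d>0. \<forall>x. dist x y < d \<longrightarrow> dist (G x) (G y) < e"
      using G e(1) by (auto simp: continuous_on_iff)
    then obtain d0 where d0: "0 < d0" "\<And>x. dist x y < d0 \<Longrightarrow> e < G x"
      using e(2) by (auto simp: dist_real_def abs_less_iff)
    \<comment> \<open>The bound \<open>d0 / 3\<close> puts the cube of half-width \<open>d\<close>
      around \<open>y\<close> into the ball of radius \<open>d0\<close>, \<open>pi\<close> gives
      monotonicity of the cosine, and the distances to the faces keep other points of the cell from
      being close to \<open>y\<close> modulo the periods.\<close>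
    define d where "d = Min ({d0 / 3, pi} \<union> (\<lambda>i. y $ i) ` UNIV \<union> (\<lambda>i. 2 * pi - y $ i) ` UNIV)"
    have d_pos: "0 < d"
      unfolding d_def using d0(1) y by (subst Min_gr_iff) auto
    have d_le: "d \<le> d0 / 3" "d \<le> pi" "d \<le> y $ i" "d \<le> 2 * pi - y $ i" for i
      unfolding d_def by (rule Min_le; simp)+
    define r where "r = (1 + cos d) / 2"
    have "cos d < cos 0"
      using d_pos d_le(2) by (intro cos_monotone_0_pi) auto
    then have r: "0 \<le> r" "r < 1"
      using cos_ge_minus_one[of d] unfolding r_def by (simp_all, linarith)
    \<comment> \<open>Away from the cube the peak is at most \<open>r\<close>. A level
      \<open>s\<close> strictly between \<open>r\<close> and the maximum 1 is still exceeded near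
      \<open>y\<close>, and there the \<open>n\<close>-th powers outgrow
      \<open>r ^ n\<close>.\<close>
    define s where "s = (1 + r) / 2"
    have s: "r < s" "0 < s" "s < 1" using r by (auto simp: s_def)
    have G_ge: "e < G x \<or> peak y x \<le> r" if "x \<in> torus_cell" for x
    proof (cases "\<forall>i. \<bar>x $ i - y $ i\<bar> < d")
      case True
      have "dist x y \<le> (\<Sum>i\<in>UNIV. \<bar>(x - y) $ i\<bar>)"
        unfolding dist_norm by (rule norm_le_l1_cart)
      also have "\<dots> < 3 * d"
        using True[rule_format, of 1] True[rule_format, of 2] True[rule_format, of 3]
        by (simp add: sum_3)
      finally show ?thesis
        using d_le(1) d0(2) by auto
    next
      case False
      then obtain i where i: "d \<le> \<bar>x $ i - y $ i\<bar>" by (auto simp: not_less)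
      have xi: "0 \<le> x $ i" "x $ i \<le> 2 * pi"
        using that by (auto simp: mem_box_cart)
      have "cos \<bar>x $ i - y $ i\<bar> \<le> cos d"
      proof (cases "\<bar>x $ i - y $ i\<bar> \<le> pi")
        case True
        then show ?thesis using i d_pos by (intro cos_monotone_0_pi_le) auto
      next
        case False
        \<comment> \<open>Beyond \<open>pi\<close> the distance around the circle counts; it is
          still at least \<open>d\<close> because \<open>y\<close> is that far from both
          faces.\<close>
        have "cos (2 * pi - \<bar>x $ i - y $ i\<bar>) \<le> cos d"
          using False xi d_le(3,4)[of i] d_pos by (intro cos_monotone_0_pi_le) auto
        then show ?thesis by (simp add: cos_diff)
      qed
      then show ?thesis
        using peak_le[of y x i] by (simp add: r_def)
    qed
    define \<phi> where "\<phi> x = max 0 (peak y x - s)" for x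
    have peak_cont: "continuous_on UNIV (peak y)"
      by (rule trig_poly_continuous[OF trig_poly_peak])
    have \<phi>: "continuous_on UNIV \<phi>" "periodic \<phi>"
      using periodic_peak by (auto simp: \<phi>_def[abs_def] periodic_def intro!: continuous_intros peak_cont)
    have "\<phi> y \<noteq> 0"
      using s by (simp add: \<phi>_def peak_def)
    then have "average \<phi> \<noteq> 0"
      using average_eq_0D[OF \<phi>, of y] by (auto simp: \<phi>_def)
    moreover have "0 \<le> average \<phi>"
      using average_mono[OF continuous_on_const \<phi>(1), of 0] by (simp add: average_const \<phi>_def)
    ultimately have avg: "0 < average \<phi>" by simp
    \<comment> \<open>Where the peak exceeds \<open>r\<close>, \<open>G\<close> is above
      \<open>e\<close>; elsewhere a negative \<open>G\<close> costs at most
      \<open>B * r ^ n\<close>. Averaging this against the vanishing moment of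
      \<open>peak y x ^ n\<close> gives the bound, which fails for large \<open>n\<close> as
      \<open>r < s\<close>.\<close>
    have le: "e * s ^ n * average \<phi> - (B + e) * r ^ n \<le> 0" for n
    proof -
      have pw: "e * s ^ n * \<phi> x - (B + e) * r ^ n \<le> peak y x ^ n * G x"
        if x: "x \<in> torus_cell" for x
      proof -
        have p: "s ^ n * \<phi> x \<le> peak y x ^ n"
        proof (cases "s \<le> peak y x")
          case True
          have "s ^ n * \<phi> x \<le> s ^ n * 1"
            using True s peak_le_1[of y x] by (intro mult_left_mono) (auto simp: \<phi>_def)
          also have "\<dots> \<le> peak y x ^ n"
            using True s by (simp add: power_mono)
          finally show ?thesis .
        qed (use peak_nonneg[of y x] in \<open>simp add: \<phi>_def\<close>)
        show ?thesis
        proof (cases "peak y x \<le> r")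
          case True
          have "e * (s ^ n * \<phi> x) \<le> e * r ^ n"
            using p power_mono[OF True peak_nonneg, of n] e by (intro mult_left_mono) auto
          moreover have "- (peak y x ^ n * G x) \<le> r ^ n * B"
          proof -
            have "- (peak y x ^ n * G x) \<le> \<bar>peak y x ^ n * G x\<bar>" by simp
            also have "\<dots> \<le> r ^ n * B"
              unfolding abs_mult using power_mono[OF True peak_nonneg, of n] GB peak_nonneg[of y x] r
              by (intro mult_mono) (auto simp: power_abs)
            finally show ?thesis .
          qed
          ultimately show ?thesis by (simp add: algebra_simps)
        next
          case False
          then have "e < G x" using G_ge[OF x] by simp
          have "e * (s ^ n * \<phi> x) \<le> e * peak y x ^ n"
            using p e by (intro mult_left_mono) auto
          also have "\<dots> \<le> peak y x ^ n * G x"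
            using \<open>e < G x\<close> peak_nonneg[of y x] by (simp add: mult.commute mult_right_mono)
          finally show ?thesis
            using B0 e r by (simp add: mult.assoc) (smt (verit) mult_nonneg_nonneg zero_le_power)
        qed
      qed
      have "e * s ^ n * average \<phi> - (B + e) * r ^ n = average (\<lambda>x. e * s ^ n * \<phi> x - (B + e) * r ^ n)"
        by (simp add: average_diff average_mult average_const continuous_intros \<phi>)
      also have "\<dots> \<le> average (\<lambda>x. peak y x ^ n * G x)"
        by (intro average_mono pw) (auto intro!: continuous_intros \<phi> peak_cont G)
      also have "\<dots> = 0"
      proof (rule average_trig_poly_eq_0[OF trig_poly_power[OF trig_poly_peak] G])
        fix k c
        have "average (\<lambda>x. sgn (g y) * (wave k c x * g x)) = 0"
          by (subst average_mult) (auto intro!: continuous_intros continuous_wave g simp: orth)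
        then show "average (\<lambda>x. wave k c x * G x) = 0"
          by (simp add: G_def mult.left_commute)
      qed
      finally show ?thesis .
    qed
    have "e * average \<phi> \<le> (B + e) * (r / s) ^ n" for n
      using le[of n] s by (simp add: power_divide field_simps)
    moreover have "(\<lambda>n. (B + e) * (r / s) ^ n) \<longlonglongrightarrow> (B + e) * 0"
      using r s by (intro tendsto_intros LIMSEQ_power_zero) auto
    ultimately have "e * average \<phi> \<le> (B + e) * 0"
      by (intro LIMSEQ_le_const) auto
    then show False
      using e avg by (simp add: mult_le_0_iff)
  qed
qed

section \<open>Fourier modes as convolutions with waves\<close>

lemma convolution_eq:
  assumes K: "continuous_on UNIV K" "periodic K" and h: "continuous_on UNIV h" "periodic h"
  shows "convolution K h x = average (\<lambda>y. K (y - x) * h y)"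
proof -
  have "periodic (\<lambda>y. K (y - x) * h y)"
    using K(2) h(2) unfolding periodic_def by (metis add_diff_eq add.commute)
  moreover have "continuous_on UNIV (\<lambda>y. K (y - x) * h y)"
    by (auto intro!: continuous_intros h continuous_on_compose2[OF K(1)])
  ultimately show ?thesis
    using average_shift[of "\<lambda>y. K (y - x) * h y" x] by (simp add: convolution_def add.commute)
qed

text \<open>Exhibits the mode at \<open>x\<close> as a Fourier coefficient with phase depending on
  \<open>x\<close>, so the multiplier identities for coefficients carry over to
  convolutions.\<close>

lemma convolution_wave:
  assumes "continuous_on UNIV h" "periodic h"
  shows "convolution (wave k 0) h x = average (\<lambda>y. wave k (- (freq k \<bullet> x)) y * h y)"
  by (simp add: convolution_eq[OF continuous_wave periodic_wave assms] wave_def inner_diff_right)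

text \<open>By Fubini and orthogonality, the frequencies \<open>l\<close> and \<open>- l\<close>
  each carry half of the coefficient. For \<open>l = 0\<close> they coincide and both halves sit at
  the same \<open>k\<close>, so summing over \<open>k\<close> always yields the whole
  coefficient.\<close>

lemma average_wave_mult_convolution_wave:
  assumes h: "continuous_on UNIV h" "periodic h"
  shows "average (\<lambda>x. wave l c x * convolution (wave k 0) h x)
    = (if k = - l then average (\<lambda>y. wave l c y * h y) / 2 else 0)
      + (if k = l then average (\<lambda>y. wave l c y * h y) / 2 else 0)"
proof -
  have sym: "wave k (- (freq k \<bullet> x)) y = wave k (- (freq k \<bullet> y)) x" for x y
    using cos_minus[of "freq k \<bullet> x - freq k \<bullet> y"] by (simp add: wave_def)
  have "average (\<lambda>x. wave l c x * convolution (wave k 0) h x)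
      = average (\<lambda>x. average (\<lambda>y. h y * (wave l c x * wave k (- (freq k \<bullet> y)) x)))"
  proof -
    have "wave l c x * convolution (wave k 0) h x
        = average (\<lambda>y. wave l c x * (wave k (- (freq k \<bullet> x)) y * h y))" for x
      by (subst average_mult) (auto intro!: continuous_intros continuous_wave h simp: convolution_wave h)
    then show ?thesis
      by (simp add: sym mult_ac)
  qed
  also have "\<dots> = average (\<lambda>y. average (\<lambda>x. h y * (wave l c x * wave k (- (freq k \<bullet> y)) x)))"
    by (rule average_swap)
      (auto simp: wave_def split_beta intro!: continuous_intros continuous_on_compose2[OF h(1)])
  also have "\<dots> = average (\<lambda>y. h y * average (\<lambda>x. wave l c x * wave k (- (freq k \<bullet> y)) x))"
    by (simp add: average_mult continuous_on_mult continuous_wave)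
  also have "\<dots> = average (\<lambda>y. ((if k = - l then 1 / 2 else 0) + (if k = l then 1 / 2 else 0))
      * (wave l c y * h y))"
    unfolding average_wave_mult
    by (rule arg_cong[where f = average]) (auto simp: fun_eq_iff wave_def freq_minus algebra_simps)
  also have "\<dots> = ((if k = - l then 1 / 2 else 0) + (if k = l then 1 / 2 else 0))
      * average (\<lambda>y. wave l c y * h y)"
    by (intro average_mult continuous_intros continuous_wave h)
  finally show ?thesis
    by (simp split: if_splits)
qed

text \<open>The coefficients of the bounded function \<open>bessel3 f\<close> are bounded, and they
  are those of \<open>f\<close> multiplied by \<open>weight k\<close>.\<close>

lemma convolution_wave_bound:
  assumes f: "smooth f" "periodic f"
  obtains B where "\<And>k x. \<bar>convolution (wave k 0) f x\<bar> \<le> B * (1 / weight k)"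
proof -
  note h = smooth_continuous[OF smooth_bessel3[OF f(1)]] periodic_bessel3[OF f]
  obtain B where B: "\<And>x. \<bar>bessel3 f x\<bar> \<le> B"
    using periodic_bounded[OF h] by blast
  have "\<bar>convolution (wave k 0) f x\<bar> \<le> B * (1 / weight k)" for k x
  proof -
    have "\<bar>wave k c y * bessel3 f y\<bar> \<le> 1 * B" for c y
      unfolding abs_mult by (rule mult_mono) (use abs_wave_le_1 B in auto)
    then have "\<bar>average (\<lambda>y. wave k (- (freq k \<bullet> x)) y * bessel3 f y)\<bar> \<le> B"
      by (intro average_abs_le continuous_on_mult continuous_wave h) auto
    then have "weight k * \<bar>convolution (wave k 0) f x\<bar> \<le> B"
      using weight_ge_1[of k]
      by (simp add: average_wave_bessel3 f convolution_wave smooth_continuous abs_mult)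
    then show ?thesis
      using weight_ge_1[of k] by (simp add: field_simps)
  qed
  then show thesis by (rule that)
qed

text \<open>The decay bound makes the sum \<open>G\<close> continuous and allows averaging term by
  term against a wave; \<open>G - f\<close> is then orthogonal to every wave and must
  vanish.\<close>

lemma fourier_inversion:
  assumes f: "smooth f" "periodic f"
  shows "((\<lambda>k. convolution (wave k 0) f x) has_sum f x) UNIV"
proof -
  note cf = smooth_continuous[OF f(1)]
  obtain B where B: "\<And>k x. \<bar>convolution (wave k 0) f x\<bar> \<le> B * (1 / weight k)"
    using convolution_wave_bound[OF f] by blast
  have M: "(\<lambda>k. B * (1 / weight k)) summable_on UNIV"
    by (intro summable_on_cmult_right summable_inverse_weight)
  define G where "G x = (\<Sum>\<^sub>\<infinity>k. convolution (wave k 0) f x)" for x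
  have cc: "continuous_on UNIV (convolution (wave k 0) f)" for k
    by (intro smooth_continuous smooth_convolution continuous_wave f)
  have G: "continuous_on UNIV G"
    unfolding G_def by (rule continuous_infsum[OF cc B M])
  have "periodic G"
    using periodic_convolution[OF f(2)] by (simp add: G_def periodic_def)
  have summ: "(\<lambda>k. convolution (wave k 0) f x) summable_on UNIV" for x
    by (rule Infinite_Sum.abs_summable_summable,
        rule Infinite_Sum.abs_summable_on_comparison_test'[OF M]) (use B in simp)
  have "average (\<lambda>x. wave l c x * (G x - f x)) = 0" for l c
  proof -
    let ?V = "average (\<lambda>y. wave l c y * f y)"
    have "\<bar>wave l c x * convolution (wave k 0) f x\<bar> \<le> 1 * (B * (1 / weight k))" for k x
      unfolding abs_mult by (rule mult_mono) (use abs_wave_le_1 B in auto)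
    then have "((\<lambda>k. average (\<lambda>x. wave l c x * convolution (wave k 0) f x)) has_sum
        average (\<lambda>x. \<Sum>\<^sub>\<infinity>k. wave l c x * convolution (wave k 0) f x)) UNIV"
      by (intro has_sum_average[OF _ _ M] continuous_on_mult continuous_wave cc) auto
    moreover have "(\<lambda>x. \<Sum>\<^sub>\<infinity>k. wave l c x * convolution (wave k 0) f x) = (\<lambda>x. wave l c x * G x)"
      unfolding G_def by (rule ext, rule infsum_cmult_right[OF summ])
    ultimately have 1: "((\<lambda>k. average (\<lambda>x. wave l c x * convolution (wave k 0) f x)) has_sum
        average (\<lambda>x. wave l c x * G x)) UNIV"
      by (simp only:)
    have single: "((\<lambda>k. if k = m then ?V / 2 else 0) has_sum ?V / 2) UNIV" for m :: "int^3"
      by (rule has_sum_finite_neutralI[of "{m}"]) auto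
    have "((\<lambda>k. average (\<lambda>x. wave l c x * convolution (wave k 0) f x)) has_sum ?V / 2 + ?V / 2) UNIV"
      unfolding average_wave_mult_convolution_wave[OF cf f(2)] by (rule has_sum_add[OF single single])
    with 1 have "average (\<lambda>x. wave l c x * G x) = ?V / 2 + ?V / 2"
      by (rule has_sum_unique)
    then show ?thesis
      by (simp add: right_diff_distrib average_diff continuous_on_mult continuous_wave G cf)
  qed
  moreover have "periodic (\<lambda>x. G x - f x)"
    using \<open>periodic G\<close> f(2) by (simp add: periodic_def)
  ultimately have "G x - f x = 0"
    using orthogonal_to_waves_imp_zero[OF continuous_on_diff[OF G cf]] by blast
  then show ?thesis
    using has_sum_infsum[OF summ, of x] by (simp add: G_def)
qed


section \<open>The Poisson equation\<close>

text \<open>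
  The Fourier multiplier \<open>1 / |k|\<^sup>2\<close> of the Poisson equation is not summable over the lattice.
  Dividing by \<open>weight k\<close> makes it summable, and \<open>bessel3\<close>, which multiplies the coefficients by
  \<open>weight k\<close>, compensates; so \<open>green\<close> is convolution with a continuous kernel.
\<close>

definition green_kernel :: "real^3 \<Rightarrow> real"
  where "green_kernel y = (\<Sum>\<^sub>\<infinity>k\<in>-{0}. wave k 0 y / ((norm (freq k))\<^sup>2 * weight k))"

definition green :: "(real^3 \<Rightarrow> real) \<Rightarrow> real^3 \<Rightarrow> real"
  where "green f = convolution green_kernel (bessel3 f)"

lemma norm_freq_ge_1:
  assumes "k \<noteq> 0"
  shows "1 \<le> (norm (freq k))\<^sup>2"
proof -
  obtain i where "k $ i \<noteq> 0"
    using assms by (auto simp: vec_eq_iff)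
  then have "(1::int) \<le> \<bar>k $ i\<bar>" by simp
  then have "1 \<le> \<bar>freq k $ i\<bar>"
    unfolding freq_nth by linarith
  also have "\<dots> \<le> norm (freq k)"
    by (rule component_le_norm_cart)
  finally show ?thesis by (simp add: one_le_power)
qed

lemma green_kernel_term_bound:
  assumes "k \<noteq> 0"
  shows "\<bar>wave k 0 y / ((norm (freq k))\<^sup>2 * weight k)\<bar> \<le> 1 / weight k"
proof -
  have "weight k \<le> (norm (freq k))\<^sup>2 * weight k"
    using norm_freq_ge_1[OF assms] weight_ge_1[of k] by simp
  then show ?thesis
    unfolding abs_divide using abs_wave_le_1[of k 0 y] weight_ge_1[of k]
    by (intro frac_le) auto
qed

lemma summable_inverse_weight_subset: "(\<lambda>k. 1 / weight k) summable_on A"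
  by (rule summable_on_subset_banach[OF summable_inverse_weight]) simp

lemma continuous_green_term:
  "continuous_on UNIV (\<lambda>y. wave k 0 y / ((norm (freq k))\<^sup>2 * weight k))"
  using continuous_on_mult_right[OF continuous_wave[of k 0], of "1 / ((norm (freq k))\<^sup>2 * weight k)"]
  by simp

lemma continuous_green_kernel: "continuous_on UNIV green_kernel"
  unfolding green_kernel_def[abs_def]
  by (rule continuous_infsum[where M = "\<lambda>k. 1 / weight k", OF continuous_green_term _
      summable_inverse_weight_subset]) (use green_kernel_term_bound in auto)

text \<open>The kernel series is dominated by \<open>1 / weight k\<close> and \<open>h\<close> is
  bounded, so the average may be taken term by term.\<close>

lemma convolution_green_kernel:
  assumes h: "continuous_on UNIV h" "periodic h"
  shows "((\<lambda>k. convolution (wave k 0) h x / ((norm (freq k))\<^sup>2 * weight k)) has_sum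
    convolution green_kernel h x) (-{0})"
proof -
  let ?a = "\<lambda>k. (norm (freq k))\<^sup>2 * weight k"
  obtain B where B: "\<And>x. \<bar>h x\<bar> \<le> B"
    using periodic_bounded[OF h] by blast
  have c: "continuous_on UNIV (\<lambda>y. h (x + y))"
    by (rule continuous_on_compose2[OF h(1)]) (auto intro!: continuous_intros)
  have M: "(\<lambda>k. 1 / weight k * B) summable_on (-{0})"
    by (intro summable_on_cmult_left summable_inverse_weight_subset)
  have "\<bar>wave k 0 y / ?a k * h (x + y)\<bar> \<le> 1 / weight k * B" if "k \<in> -{0}" for k y
    unfolding abs_mult
    by (rule mult_mono) (use that green_kernel_term_bound B weight_ge_1[of k] in \<open>auto simp del: abs_divide\<close>)
  then have "((\<lambda>k. average (\<lambda>y. wave k 0 y / ?a k * h (x + y))) has_sum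
      average (\<lambda>y. \<Sum>\<^sub>\<infinity>k\<in>-{0}. wave k 0 y / ?a k * h (x + y))) (-{0})"
    by (intro has_sum_average[OF _ _ M] continuous_on_mult c continuous_green_term) auto
  moreover have "(\<Sum>\<^sub>\<infinity>k\<in>-{0}. wave k 0 y / ?a k * h (x + y)) = green_kernel y * h (x + y)" for y
  proof -
    have "(\<lambda>k. wave k 0 y / ?a k) summable_on -{0}"
      by (rule Infinite_Sum.abs_summable_summable,
          rule Infinite_Sum.abs_summable_on_comparison_test'[OF summable_inverse_weight_subset])
        (use green_kernel_term_bound in auto)
    then show ?thesis
      unfolding green_kernel_def by (rule infsum_cmult_left)
  qed
  moreover have "average (\<lambda>y. wave k 0 y / ?a k * h (x + y)) = convolution (wave k 0) h x / ?a k" for k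
    using average_mult[of "\<lambda>y. wave k 0 y * h (x + y)" "1 / ?a k"] continuous_on_mult[OF continuous_wave c]
    by (simp add: convolution_def)
  ultimately show ?thesis
    by (simp add: convolution_def)
qed

lemma smooth_green: "smooth f \<Longrightarrow> smooth (green f)"
  unfolding green_def by (intro smooth_convolution continuous_green_kernel smooth_bessel3)

lemma periodic_green: "smooth f \<Longrightarrow> periodic f \<Longrightarrow> periodic (green f)"
  unfolding green_def by (intro periodic_convolution periodic_bessel3)

text \<open>Moved onto \<open>bessel3 f\<close>, the Laplacian multiplies mode \<open>k\<close> by
  minus the denominator in the kernel. What remains is minus the inversion series of
  \<open>f\<close> with the mode \<open>k = 0\<close>, the average, left out.\<close>

lemma laplacian_green:
  assumes f: "smooth f" "periodic f"
  shows "laplacian (green f) x = average f - f x"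
proof -
  let ?h = "bessel3 f"
  note h = smooth_bessel3[OF f(1)] periodic_bessel3[OF f]
  note L = smooth_continuous[OF smooth_laplacian[OF h(1)]] periodic_laplacian[OF h]
  have p: "partial i (green f) = convolution green_kernel (partial i ?h)" for i
    unfolding green_def by (rule ext, rule partial_convolution[OF continuous_green_kernel h(1)])
  have pp: "partial i (partial i (green f)) = convolution green_kernel (partial i (partial i ?h))" for i
    unfolding p by (rule ext, rule partial_convolution[OF continuous_green_kernel smooth_partial[OF h(1)]])
  have "laplacian (green f) x = convolution green_kernel (laplacian ?h) x"
  proof -
    have "continuous_on UNIV (\<lambda>y. green_kernel y * partial i (partial i ?h) (x + y))" for i
      by (intro continuous_on_mult continuous_green_kernel
          continuous_on_compose2[OF smooth_continuous[OF smooth_partial[OF smooth_partial[OF h(1)]]]])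
        (auto intro!: continuous_intros)
    then show ?thesis
      by (simp add: laplacian_def pp convolution_def sum_distrib_left average_sum)
  qed
  moreover have "((\<lambda>k. - convolution (wave k 0) f x) has_sum convolution green_kernel (laplacian ?h) x) (-{0})"
  proof -
    have "convolution (wave k 0) (laplacian ?h) x / ((norm (freq k))\<^sup>2 * weight k)
        = - convolution (wave k 0) f x" if "k \<in> -{0}" for k
    proof -
      have "(norm (freq k))\<^sup>2 * weight k \<noteq> 0"
        using norm_freq_ge_1[of k] weight_ge_1[of k] that by auto
      moreover have "convolution (wave k 0) (laplacian ?h) x
          = - ((norm (freq k))\<^sup>2 * weight k) * convolution (wave k 0) f x"
        by (simp add: convolution_wave L average_wave_laplacian h average_wave_bessel3 f smooth_continuous)
      ultimately show ?thesis
        by (metis nonzero_mult_div_cancel_left minus_divide_left mult_minus_left)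
    qed
    then show ?thesis
      using convolution_green_kernel[OF L, of x] has_sum_cong by (metis (no_types, lifting))
  qed
  moreover have "((\<lambda>k. - convolution (wave k 0) f x) has_sum - (f x - average f)) (-{0})"
  proof -
    have "wave 0 0 = (\<lambda>y. 1)"
      by (simp add: wave_def fun_eq_iff)
    then have "convolution (wave 0 0) f x = average f"
      using convolution_wave[OF smooth_continuous[OF f(1)] f(2), of 0 x] by simp
    then have "((\<lambda>k. convolution (wave k 0) f x) has_sum average f) {0}"
      using has_sum_finite[of "{0}" "\<lambda>k. convolution (wave k 0) f x"] by simp
    then have "((\<lambda>k. convolution (wave k 0) f x) has_sum f x - average f) (UNIV - {0})"
      by (rule has_sum_Diff[OF fourier_inversion[OF f]]) simp
    then show ?thesis
      by (simp only: Compl_eq_Diff_UNIV has_sum_uminus minus_minus)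
  qed
  ultimately have "laplacian (green f) x = - (f x - average f)"
    using has_sum_unique by metis
  then show ?thesis by simp
qed

section \<open>The vector potential and its divergence\<close>

lemma bessel_partial:
  assumes "smooth f"
  shows "bessel j (partial i f) = partial i (bessel j f)"
proof
  fix x
  have "partial j (partial j (partial i f)) x = partial j (partial i (partial j f)) x"
    using partial_commute[OF assms, of j i] by presburger
  also have "\<dots> = partial i (partial j (partial j f)) x"
    by (rule partial_commute[OF smooth_partial[OF assms]])
  finally show "bessel j (partial i f) x = partial i (bessel j f) x"
    by (simp add: bessel_def[abs_def] partial_diff smooth_partial assms)
qed

lemma bessel_sum:
  assumes "\<And>i. i \<in> I \<Longrightarrow> smooth (f i)"
  shows "bessel j (\<lambda>x. \<Sum>i\<in>I. f i x) = (\<lambda>x. \<Sum>i\<in>I. bessel j (f i) x)"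
proof -
  have "partial j (\<lambda>x. \<Sum>i\<in>I. f i x) = (\<lambda>x. \<Sum>i\<in>I. partial j (f i) x)"
    by (rule ext, rule partial_sum[OF assms])
  then show ?thesis
    by (simp add: bessel_def[abs_def] partial_sum smooth_partial assms sum_subtractf)
qed

lemma bessel3_partial: "smooth f \<Longrightarrow> bessel3 (partial i f) = partial i (bessel3 f)"
  by (simp add: bessel3_def bessel_partial smooth_bessel)

lemma bessel3_sum:
  "(\<And>i. i \<in> I \<Longrightarrow> smooth (f i)) \<Longrightarrow> bessel3 (\<lambda>x. \<Sum>i\<in>I. f i x) = (\<lambda>x. \<Sum>i\<in>I. bessel3 (f i) x)"
  by (simp add: bessel3_def bessel_sum smooth_bessel)

lemma bessel3_0: "bessel3 (\<lambda>x. 0) = (\<lambda>x. 0)"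
proof -
  have "partial i (\<lambda>x. 0) = (\<lambda>x. 0::real)" for i
    by (rule ext, rule partial_const)
  then have "bessel i (\<lambda>x. 0) = (\<lambda>x. 0)" for i
    by (simp add: bessel_def[abs_def])
  then show ?thesis by (simp add: bessel3_def)
qed

definition green_vec :: "(real^3 \<Rightarrow> real^3) \<Rightarrow> real^3 \<Rightarrow> real^3"
  where "green_vec w x = (\<chi> i. green (\<lambda>x. w x $ i) x)"

lemma smooth_green_vec:
  assumes "smooth w"
  shows "smooth (green_vec w)"
proof -
  have "green_vec w = (\<lambda>x. \<Sum>i\<in>UNIV. green (\<lambda>x. w x $ i) x *\<^sub>R axis i 1)"
    by (simp add: green_vec_def vec_eq_iff fun_eq_iff axis_def if_distrib cong: if_cong)
  then show ?thesis
    using assms by (auto intro!: smooth_sum smooth_bilinear[OF bounded_bilinear_scaleR]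
        smooth_green smooth_nth smooth_const)
qed

lemma periodic_nth: "periodic w \<Longrightarrow> periodic (\<lambda>x. w x $ i)"
  by (simp add: periodic_def)

lemma periodic_green_vec:
  assumes "smooth w" "periodic w"
  shows "periodic (green_vec w)"
proof -
  have "green (\<lambda>x. w x $ j) (x + axis i (2 * pi)) = green (\<lambda>x. w x $ j) x" for i j x
    using periodic_green[OF smooth_nth[OF assms(1)] periodic_nth[OF assms(2)], of j]
    by (simp add: periodic_def)
  then show ?thesis
    by (simp add: periodic_def green_vec_def vec_eq_iff)
qed

lemma partial_green_vec_nth:
  assumes "smooth w"
  shows "(\<lambda>x. partial j (green_vec w) x $ i) = partial j (green (\<lambda>x. w x $ i))"
  using partial_nth[OF smooth_green_vec[OF assms], of j i] by (simp add: green_vec_def fun_eq_iff)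

text \<open>Derivatives commute with \<open>bessel3\<close> and pass through the convolution, so the
  divergence is the kernel convolved with \<open>bessel3\<close> of the divergence of
  \<open>w\<close>.\<close>

lemma divergence_green_vec:
  assumes w: "smooth w" and "\<And>x. divergence w x = 0"
  shows "divergence (green_vec w) x = 0"
proof -
  let ?w = "\<lambda>i x. w x $ i"
  have s: "smooth (?w i)" for i by (rule smooth_nth[OF w])
  have p: "partial i (green (?w i)) x = convolution green_kernel (bessel3 (partial i (?w i))) x" for i
    unfolding green_def bessel3_partial[OF s]
    by (rule partial_convolution[OF continuous_green_kernel smooth_bessel3[OF s]])
  have c: "continuous_on UNIV (\<lambda>y. green_kernel y * bessel3 (partial i (?w i)) (x + y))" for i
    by (intro continuous_on_mult continuous_green_kernel continuous_on_compose2[OF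
          smooth_continuous[OF smooth_bessel3[OF smooth_partial[OF s]]]]) (auto intro!: continuous_intros)
  have "(\<Sum>i\<in>UNIV. bessel3 (partial i (?w i)) y) = 0" for y
  proof -
    have "(\<lambda>x. \<Sum>i\<in>UNIV. partial i (?w i) x) = (\<lambda>x. 0)"
      using assms(2) by (simp add: divergence_def partial_nth w)
    then show ?thesis
      using bessel3_sum[of UNIV "\<lambda>i. partial i (?w i)"] s
      by (simp add: smooth_partial bessel3_0) metis
  qed
  then have "(\<Sum>i\<in>UNIV. convolution green_kernel (bessel3 (partial i (?w i))) x) = 0"
    unfolding convolution_def
    by (subst average_sum[symmetric]) (auto simp: c average_const simp flip: sum_distrib_left)
  then show ?thesis
    using partial_green_vec_nth[OF w] by (simp add: divergence_def p fun_eq_iff)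
qed


section \<open>Vector identities\<close>

text \<open>In general the gradient of the divergence appears as a further term; \<open>div\<close>
  records that its components vanish.\<close>

lemma curl_curl:
  assumes u: "smooth u" and "\<And>x. divergence u x = 0"
  shows "curl (curl u) x $ i = - laplacian (\<lambda>x. u x $ i) x"
proof -
  note s = u smooth_partial smooth_nth
  have "(\<lambda>x. \<Sum>j\<in>UNIV. partial j u x $ j) = (\<lambda>x. 0)"
    using assms(2) by (simp add: divergence_def)
  then have "partial i (\<lambda>x. \<Sum>j\<in>UNIV. partial j u x $ j) x = 0"
    by (simp add: partial_const)
  then have div: "(\<Sum>j\<in>UNIV. partial i (partial j u) x $ j) = 0" for i
    using partial_sum[of UNIV "\<lambda>j x. partial j u x $ j" i x] assms(2)
    by (simp add: partial_nth s divergence_def partial_const)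
  have pc: "partial j (curl u) x $ 1 = partial j (partial 2 u) x $ 3 - partial j (partial 3 u) x $ 2"
    "partial j (curl u) x $ 2 = partial j (partial 3 u) x $ 1 - partial j (partial 1 u) x $ 3"
    "partial j (curl u) x $ 3 = partial j (partial 1 u) x $ 2 - partial j (partial 2 u) x $ 1" for j
    by (simp_all add: curl_nth partial_diff s smooth_curl flip: partial_nth)
  have lap: "laplacian (\<lambda>x. u x $ i) x = (\<Sum>j\<in>UNIV. partial j (partial j u) x $ i)" for i
  proof -
    have "partial j (\<lambda>x. u x $ i) = (\<lambda>x. partial j u x $ i)" for j
      by (rule ext, rule partial_nth[OF u])
    then show ?thesis by (simp add: laplacian_def partial_nth s)
  qed
  show ?thesis
    using exhaust_3[of i] div[of 1] div[of 2] div[of 3]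
    by (auto simp: lap sum_3 curl_nth pc
        partial_commute[OF u, of 2 1] partial_commute[OF u, of 3 1] partial_commute[OF u, of 3 2])
qed

lemma average_divergence:
  assumes "smooth f" "periodic f"
  shows "average (divergence f) = 0"
proof -
  have "average (divergence f) = (\<Sum>i\<in>UNIV. average (\<lambda>x. partial i (\<lambda>x. f x $ i) x))"
    by (simp add: divergence_def[abs_def] average_sum smooth_continuous smooth_nth smooth_partial
        partial_nth assms)
  also have "\<dots> = 0"
    by (simp add: average_partial smooth_nth periodic_nth assms)
  finally show ?thesis .
qed

lemma smooth_cross: "smooth u \<Longrightarrow> smooth w \<Longrightarrow> smooth (\<lambda>x. cross3 (u x) (w x))"
  by (rule smooth_bilinear[OF bilinear_cross[unfolded bilinear_conv_bounded_bilinear]])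

lemma cross_nth:
  "cross3 a b $ 1 = a $ 2 * b $ 3 - a $ 3 * b $ 2"
  "cross3 a b $ 2 = a $ 3 * b $ 1 - a $ 1 * b $ 3"
  "cross3 a b $ 3 = a $ 1 * b $ 2 - a $ 2 * b $ 1"
  by (simp_all add: cross3_def)

lemma partial_cross_nth:
  assumes u: "smooth u" and w: "smooth w"
  shows "partial i (\<lambda>x. cross3 (u x) (w x)) x $ j
    = cross3 (u x) (partial i w x) $ j + cross3 (partial i u x) (w x) $ j"
  using exhaust_3[of j]
  by (auto simp: cross_nth partial_diff partial_mult smooth_nth smooth_mult u w smooth_cross
      simp flip: partial_nth[OF smooth_cross[OF u w]])
    (simp_all add: partial_nth u w algebra_simps)

lemma divergence_cross:
  assumes "smooth u" "smooth w"
  shows "divergence (\<lambda>x. cross3 (u x) (w x)) x = w x \<bullet> curl u x - u x \<bullet> curl w x"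
  by (simp add: divergence_def partial_cross_nth assms sum_3 cross_nth inner_vec_def curl_nth algebra_simps)

text \<open>For divergence-free fields the last two terms drop out and the right side is the Lie
  bracket of \<open>w\<close> and \<open>u\<close>.\<close>

lemma curl_cross:
  assumes "smooth u" "smooth w"
  shows "curl (\<lambda>x. cross3 (u x) (w x)) x
    = advect w u x - advect u w x + divergence w x *\<^sub>R u x - divergence u x *\<^sub>R w x"
  by (simp add: vec_eq_iff forall_3 curl_nth partial_cross_nth assms cross_nth advect_def
      divergence_def sum_3 algebra_simps)

lemma average_curl:
  assumes "smooth u" "periodic u"
  shows "average (curl u) = 0"
proof -
  have "partial i (\<lambda>x. u x $ j) = (\<lambda>x. partial i u x $ j)" for i j
    by (rule ext, rule partial_nth[OF assms(1)])
  then have "average (\<lambda>x. partial i u x $ j) = 0" for i j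
    using average_partial[OF smooth_nth[OF assms(1)] periodic_nth[OF assms(2)], of i j] by simp
  then have "average (\<lambda>x. curl u x $ i) = 0" for i
    using exhaust_3[of i]
    by (auto simp: curl_nth average_diff smooth_continuous smooth_nth smooth_partial assms)
  then show ?thesis
    by (simp add: vec_eq_iff average_nth smooth_continuous smooth_curl assms)
qed

text \<open>The integrands differ by the divergence of the cross product of \<open>u\<close> and
  \<open>w\<close>, which averages to zero.\<close>

lemma average_curl_inner:
  assumes u: "smooth u" "periodic u" and w: "smooth w" "periodic w"
  shows "average (\<lambda>x. curl u x \<bullet> w x) = average (\<lambda>x. u x \<bullet> curl w x)"
proof -
  have "periodic (\<lambda>x. cross3 (u x) (w x))"
    using u w by (simp add: periodic_def)
  moreover have "divergence (\<lambda>x. cross3 (u x) (w x)) = (\<lambda>x. curl u x \<bullet> w x - u x \<bullet> curl w x)"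
    by (rule ext) (simp add: divergence_cross u w inner_commute)
  ultimately have "0 = average (\<lambda>x. curl u x \<bullet> w x - u x \<bullet> curl w x)"
    using average_divergence[OF smooth_cross[OF u(1) w(1)]] by simp
  also have "\<dots> = average (\<lambda>x. curl u x \<bullet> w x) - average (\<lambda>x. u x \<bullet> curl w x)"
    by (intro average_diff smooth_continuous smooth_bilinear[OF bounded_bilinear_inner] smooth_curl u w)
  finally show ?thesis by simp
qed


section \<open>Inverting the curl\<close>

lemma smooth_field: "smooth (field u)" and periodic_field: "periodic (field u)"
  and divergence_field: "divergence (field u) x = 0"
  using field[of u] by auto

lemma continuous_field: "continuous_on UNIV (field u)"
  by (rule smooth_continuous[OF smooth_field])

lemma continuous_field_inner: "continuous_on UNIV (\<lambda>x. field u x \<bullet> field w x)"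
  by (intro continuous_on_inner continuous_field)

lemma mean_add: "mean (u + w) = mean u + mean w"
  by (simp add: mean_def plus_solenoidal.rep_eq average_add continuous_field)

lemma mean_diff: "mean (u - w) = mean u - mean w"
  by (simp add: mean_def minus_solenoidal.rep_eq average_diff continuous_field)

lemma mean_scaleR: "mean (c *\<^sub>R u) = c *\<^sub>R mean u"
  by (simp add: mean_def scaleR_solenoidal.rep_eq average_linear[OF bounded_linear_scaleR_right] continuous_field)

lemma mean_const_field: "mean (const_field c) = c"
  by (simp add: mean_def const_field.rep_eq average_const)

lemma mean_curl_field: "mean (curl_field u) = 0"
  by (simp add: mean_def curl_field.rep_eq average_curl smooth_field periodic_field)

lemma curl_field_add: "curl_field (u + w) = curl_field u + curl_field w"
  by transfer (simp add: fun_eq_iff vec_eq_iff forall_3 curl_nth partial_add)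

lemma curl_field_scaleR: "curl_field (c *\<^sub>R u) = c *\<^sub>R curl_field u"
  by transfer (simp add: fun_eq_iff vec_eq_iff forall_3 curl_nth partial_scaleR_const algebra_simps)

definition pairing :: "solenoidal \<Rightarrow> solenoidal \<Rightarrow> real"
  where "pairing u w = average (\<lambda>x. field u x \<bullet> field w x)"

lemma pairing_commute: "pairing u w = pairing w u"
  by (simp add: pairing_def inner_commute)

lemma pairing_add: "pairing (u + v) w = pairing u w + pairing v w"
  by (simp add: pairing_def plus_solenoidal.rep_eq inner_add_left average_add continuous_field_inner)

lemma pairing_scaleR: "pairing (c *\<^sub>R u) w = c * pairing u w"
  by (simp add: pairing_def scaleR_solenoidal.rep_eq average_mult continuous_field_inner)

lemma pairing_curl_field: "pairing (curl_field u) w = pairing u (curl_field w)"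
  by (simp add: pairing_def curl_field.rep_eq average_curl_inner smooth_field periodic_field)

lemma pairing_self_eq_0:
  assumes "pairing u u = 0"
  shows "u = 0"
proof -
  have "periodic (\<lambda>x. field u x \<bullet> field u x)"
    using periodic_field[of u] by (simp add: periodic_def)
  then have "field u x \<bullet> field u x = 0" for x
    by (rule average_eq_0D[OF continuous_field_inner]) (use assms in \<open>simp_all add: pairing_def\<close>)
  then have "field u = field 0"
    by (simp add: zero_solenoidal.rep_eq fun_eq_iff)
  then show ?thesis by (simp add: field_inject)
qed

lemma curl_field_surj:
  assumes "w \<in> zero_mean"
  obtains v where "v \<in> zero_mean" "curl_field v = w"
proof -
  let ?g = "green_vec (field w)"
  note w = smooth_field[of w] periodic_field[of w]
  note g = smooth_green_vec[OF w(1)] periodic_green_vec[OF w]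
  define v where "v = Solenoidal (curl ?g)"
  have v: "field v = curl ?g"
    unfolding v_def
    by (rule Solenoidal_inverse) (simp add: smooth_curl periodic_curl divergence_curl g)
  have "curl (curl ?g) x $ i = field w x $ i" for x i
  proof -
    have "curl (curl ?g) x $ i = - laplacian (green (\<lambda>x. field w x $ i)) x"
      by (simp add: curl_curl g divergence_green_vec w divergence_field) (simp add: green_vec_def)
    \<comment> \<open>The Poisson equation is solved only up to the average, which is zero for
      \<open>w\<close>.\<close>
    also have "\<dots> = field w x $ i - mean w $ i"
      by (simp add: laplacian_green smooth_nth periodic_nth w mean_def average_nth continuous_field)
    finally show ?thesis using assms by (simp add: zero_mean_def)
  qed
  then have "field (curl_field v) = field w"
    by (simp add: curl_field.rep_eq v fun_eq_iff vec_eq_iff)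
  then have "curl_field v = w" by (simp add: field_inject)
  moreover have "v \<in> zero_mean"
    by (simp add: zero_mean_def mean_def v average_curl g)
  ultimately show thesis by (rule that[rotated])
qed

text \<open>If \<open>curl z = 0\<close> and \<open>z = curl v\<close>, then the pairing of
  \<open>z\<close> with itself equals that of \<open>v\<close> with \<open>curl z\<close>, which is
  zero.\<close>

lemma curl_field_inj: "inj_on curl_field zero_mean"
proof (rule inj_onI)
  fix u w assume uw: "u \<in> zero_mean" "w \<in> zero_mean" "curl_field u = curl_field w"
  define z where "z = u + (-1) *\<^sub>R w"
  have "z \<in> zero_mean"
    using uw by (simp add: z_def zero_mean_def mean_diff)
  then obtain v where v: "curl_field v = z"
    using curl_field_surj by blast
  have "curl_field z = 0"
    using uw(3) unfolding z_def curl_field_add curl_field_scaleR by simp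
  then have "pairing z z = 0"
    using pairing_curl_field[of v z] pairing_scaleR[of 0 0 v] by (simp add: v pairing_commute)
  then have "z = 0" by (rule pairing_self_eq_0)
  then show "u = w" by (simp add: z_def)
qed

lemma curl_inv_in: "w \<in> zero_mean \<Longrightarrow> curl_inv w \<in> zero_mean"
  and curl_field_curl_inv: "w \<in> zero_mean \<Longrightarrow> curl_field (curl_inv w) = w"
proof -
  assume w: "w \<in> zero_mean"
  then obtain v where v: "v \<in> zero_mean" "curl_field v = w"
    by (rule curl_field_surj)
  then have "curl_inv w = v"
    unfolding curl_inv_def using the_inv_into_f_f[OF curl_field_inj v(1)] by simp
  then show "curl_inv w \<in> zero_mean" "curl_field (curl_inv w) = w" using v by auto
qed

lemma curl_inv_eqI: "v \<in> zero_mean \<Longrightarrow> curl_field v = w \<Longrightarrow> curl_inv w = v"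
  unfolding curl_inv_def using the_inv_into_f_f[OF curl_field_inj] by blast

lemma zero_mean_scaleR: "u \<in> zero_mean \<Longrightarrow> c *\<^sub>R u \<in> zero_mean"
  by (simp add: zero_mean_def mean_scaleR)

lemma curl_inv_scaleR: "u \<in> zero_mean \<Longrightarrow> curl_inv (c *\<^sub>R u) = c *\<^sub>R curl_inv u"
  by (rule curl_inv_eqI)
    (simp_all add: zero_mean_scaleR curl_inv_in curl_field_scaleR curl_field_curl_inv)

text \<open>The projection onto fields of zero average. In the form \<open>curl_inv\<close> is
  applied only to its values, so the arbitrary values off \<open>zero_mean\<close> never
  enter.\<close>

definition fluct :: "solenoidal \<Rightarrow> solenoidal"
  where "fluct u = u - const_field (mean u)"

lemma fluct_in: "fluct u \<in> zero_mean"
  by (simp add: fluct_def zero_mean_def mean_diff mean_const_field)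

lemma fluct_add: "fluct (u + w) = fluct u + fluct w"
proof -
  have "const_field (a + b) = const_field a + const_field b" for a b
    by transfer simp
  then show ?thesis by (simp add: fluct_def mean_add)
qed

lemma fluct_scaleR: "fluct (c *\<^sub>R u) = c *\<^sub>R fluct u"
proof -
  have "const_field (c *\<^sub>R a) = c *\<^sub>R const_field a" for a
    by transfer simp
  then show ?thesis by (simp add: fluct_def mean_scaleR scaleR_diff_right)
qed

lemma fluct_eq: "mean u = 0 \<Longrightarrow> fluct u = u"
proof -
  have "const_field 0 = 0" by transfer simp
  then show "mean u = 0 \<Longrightarrow> fluct u = u" by (simp add: fluct_def)
qed


section \<open>The invariant form\<close>

lemma ext_form_eq:
  "ext_form (u, \<eta>) (w, \<mu>) = pairing (fluct u) (curl_inv (fluct w)) + \<eta> \<bullet> mean w + \<mu> \<bullet> mean u"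
  by (simp add: ext_form_def pairing_def fluct_def)

text \<open>Writing each fluctuation as the curl of its inverse curl, the symmetry of the curl for
  the pairing exchanges the two slots.\<close>

lemma ext_form_commute: "ext_form x y = ext_form y x"
proof -
  have "pairing (fluct u) (curl_inv (fluct w)) = pairing (fluct w) (curl_inv (fluct u))" for u w
    using pairing_curl_field[of "curl_inv (fluct u)" "curl_inv (fluct w)"]
    by (simp add: curl_field_curl_inv fluct_in pairing_commute)
  then show ?thesis
    by (cases x; cases y) (simp add: ext_form_eq)
qed

text \<open>Linearity is checked in the first slot, where \<open>curl_inv\<close> is not applied;
  symmetry transfers it to the second.\<close>

lemma bilinear_ext_form: "bilinear ext_form"
proof -
  have l: "linear (\<lambda>x. ext_form x y)" for y
    by (cases y, intro linearI; clarsimp simp: ext_form_eq fluct_add fluct_scaleR pairing_add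
        pairing_scaleR mean_add mean_scaleR algebra_simps)
  then show ?thesis
    using l ext_form_commute by (simp add: bilinear_def)
qed

lemma nondegenerate_ext_form: "nondegenerate ext_form"
  unfolding nondegenerate_def
proof (intro allI impI)
  fix X assume *: "\<forall>Y. ext_form X Y = 0"
  obtain u \<eta> where X: "X = (u, \<eta>)" by fastforce
  have z: "fluct 0 = 0" "curl_inv 0 = 0" "pairing v 0 = 0" "mean 0 = 0" for v
    using fluct_scaleR[of 0 0] curl_inv_scaleR[OF fluct_in, of 0 0] pairing_scaleR[of 0 0 v] mean_scaleR[of 0 0]
    by (simp_all add: pairing_commute)
  have "mean u \<bullet> mean u = 0"
    using *[rule_format, of "(0, mean u)"] by (simp add: X ext_form_eq z)
  then have u: "mean u = 0" by simp
  have "\<eta> \<bullet> \<eta> = 0"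
    using *[rule_format, of "(const_field \<eta>, 0)"]
    by (simp add: X ext_form_eq mean_const_field fluct_def z)
  then have \<eta>: "\<eta> = 0" by simp
  \<comment> \<open>Since \<open>mean u = 0\<close> is known by now, \<open>u\<close> itself is the
    inverse curl of \<open>curl u\<close>, and the form reduces to the squared
    \<open>L\<^sup>2\<close> norm.\<close>
  have "pairing u u = 0"
    using *[rule_format, of "(curl_field u, 0)"] u
    by (simp add: X ext_form_eq \<eta> mean_curl_field fluct_eq curl_inv_eqI zero_mean_def)
  then show "X = 0"
    using pairing_self_eq_0 by (simp add: X \<eta> zero_prod_def)
qed

text \<open>The central components all drop out: the bracket ignores those of its arguments, and
  \<open>\<mu>\<close> meets the mean of a bracket, which vanishes because a bracket is a
  curl.\<close>

lemma ext_form_ext_bracket: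
  "ext_form (ext_bracket (y, \<theta>) (u, \<eta>)) (w, \<mu>)
    = average (\<lambda>x. cross3 (field u x) (field y x) \<bullet> field w x)"
proof -
  let ?c = "\<lambda>x. cross3 (field u x) (field y x)"
  have c: "smooth ?c" "periodic ?c"
    using smooth_cross[OF smooth_field smooth_field, of u y] periodic_field[of u] periodic_field[of y]
    by (auto simp: periodic_def)
  have br: "field (bracket y u) = curl ?c"
    by (simp add: bracket.rep_eq fun_eq_iff curl_cross smooth_field divergence_field)
  have m: "mean (bracket y u) = 0"
    by (simp add: mean_def br average_curl c)
  let ?v = "curl_inv (fluct w)"
  have cv: "curl (field ?v) = (\<lambda>x. field w x - mean w)"
    using arg_cong[OF curl_field_curl_inv[OF fluct_in[of w]], of field]
    by (simp add: curl_field.rep_eq minus_solenoidal.rep_eq const_field.rep_eq fluct_def[of w])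
  have "pairing (bracket y u) ?v = average (\<lambda>x. ?c x \<bullet> (field w x - mean w))"
    by (simp add: pairing_def br average_curl_inner c smooth_field periodic_field cv)
  \<comment> \<open>The subtracted term is the average of \<open>?c\<close> paired with
    \<open>mean w\<close>, exactly what the cocycle component of the bracket adds back.\<close>
  also have "\<dots> = average (\<lambda>x. ?c x \<bullet> field w x) - average (\<lambda>x. ?c x \<bullet> mean w)"
    unfolding inner_diff_right
    by (intro average_diff continuous_intros smooth_continuous[OF c(1)] continuous_field)
  also have "average (\<lambda>x. ?c x \<bullet> mean w) = average ?c \<bullet> mean w"
    by (rule average_linear[OF bounded_linear_inner_left smooth_continuous[OF c(1)]])
  finally show ?thesis
    by (simp add: ext_bracket_def ext_form_eq m fluct_eq)
qed

text \<open>Symmetry of the form puts the bracket into the first slot of both summands; they then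
  differ by exchanging \<open>X\<close> and \<open>Z\<close>, an odd permutation in the triple
  product.\<close>

lemma ext_form_invariant: "ext_form (ext_bracket Y X) Z + ext_form X (ext_bracket Y Z) = 0"
proof -
  obtain u \<eta> y \<theta> w \<mu> where XYZ: "X = (u, \<eta>)" "Y = (y, \<theta>)" "Z = (w, \<mu>)"
    by (metis surj_pair)
  have "cross3 a b \<bullet> c = - (cross3 c b \<bullet> a)" for a b c :: "real^3"
    by (simp add: inner_vec_def sum_3 cross_nth algebra_simps)
  then have "average (\<lambda>x. cross3 (field u x) (field y x) \<bullet> field w x)
      = average (\<lambda>x. - (cross3 (field w x) (field y x) \<bullet> field u x))"
    by (rule arg_cong[where f = average, OF ext])
  also have "\<dots> = - average (\<lambda>x. cross3 (field w x) (field y x) \<bullet> field u x)"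
    by (rule average_linear[OF bounded_linear_minus[OF bounded_linear_ident]])
      (intro continuous_on_inner smooth_continuous smooth_cross smooth_field)
  finally show ?thesis
    using ext_form_commute[of X "ext_bracket Y Z"] by (simp add: XYZ ext_form_ext_bracket)
qed

theorem proposition2:
  shows "invariant_inner_product ext_bracket ext_form"
  unfolding invariant_inner_product_def
  by (intro conjI allI bilinear_ext_form ext_form_commute nondegenerate_ext_form ext_form_invariant)

end
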